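(* Let $N\geq1$, $0<\gamma_1,\gamma_2<1$, $(f(v),g(u))=(|v|^p,|u|^q)$, and let $u_0,v_0\in C_0(\mathbb{R}^N)$ with $u_0\ge0$, $v_0\ge0$, $u_0\not\equiv0$, $v_0\not\equiv0$. (a) If $p>1$, $q>1$ and either $$\frac N2<\min\Big\{\frac{p\gamma_2+\gamma_1}{\gamma_1(pq-1)},\frac{q\gamma_1+\gamma_2}{\gamma_1(pq-1)},\frac{pq(\gamma_1-\gamma_2)+q\gamma_1+\gamma_2}{\gamma_1(pq-1)},\frac{p+1}{pq-1}\Big\}$$ or $$\frac N2<\min\Big\{\frac{q\gamma_1+\gamma_2}{\gamma_2(pq-1)},\frac{p\gamma_2+\gamma_1}{\gamma_2(pq-1)},\frac{pq(\gamma_2-\gamma_1)+p\gamma_2+\gamma_1}{\gamma_2(pq-1)},\frac{q+1}{pq-1}\Big\},$$ then the mild solution $(u,v)$ of the system blows up in finite time, i.e. $T_{\max}<\infty$. (b) If $p=1$ and $1<q<1+\frac2N$, or $1<p<1+\frac2N$ and $q=1$, then the mild solution blows up in finite time.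
   Context: The system is ${}^{C}D_{0|t}^{\gamma_1}u-\Delta u=|v|^p$, ${}^{C}D_{0|t}^{\gamma_2}v-\Delta v=|u|^q$ for $t>0$, $x\in\mathbb{R}^N$, with $u(0)=u_0$, $v(0)=v_0$, where ${}^{C}D^{\alpha}_{0|t}w(t)=\frac{1}{\Gamma(1-\alpha)}\int_0^t(t-s)^{-\alpha}\partial_sw(s)\,ds$. $C_0(\mathbb{R}^N)$ is the space of continuous functions vanishing at infinity. A mild solution on $[0,T]$ is $(u,v)\in C([0,T];C_0\times C_0)$ with $u(t)=P_{\gamma_1}(t)u_0+\int_0^t(t-\tau)^{\gamma_1-1}S_{\gamma_1}(t-\tau)|v(\tau)|^p\,d\tau$, $v(t)=P_{\gamma_2}(t)v_0+\int_0^t(t-\tau)^{\gamma_2-1}S_{\gamma_2}(t-\tau)|u(\tau)|^q\,d\tau$, where $P_\alpha(t)w=\int_0^\infty\phi_\alpha(\theta)T(t^\alpha\theta)w\,d\theta$, $S_\alpha(t)w=\alpha\int_0^\infty\theta\phi_\alpha(\theta)T(t^\alpha\theta)w\,d\theta$, $T(t)$ the heat semigroup on $\mathbb{R}^N$, $\phi_\alpha(z)=\sum_{k\ge0}\frac{(-z)^k}{k!\Gamma(-\alpha k+1-\alpha)}$. Standing fact: there is a maximal existence time $T_{\max}\in(0,\infty]$ for the unique mild solution, and if $T_{\max}<\infty$ then $\|u(t)\|_\infty+\|v(t)\|_\infty\to\infty$ as $t\to T_{\max}$; "blows up in finite time" means $T_{\max}<\infty$. *)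

theory Defs
  imports "HOL-Analysis.Analysis"
begin

text \<open>Functions in C_0(R^N): continuous and vanishing at infinity.
  The space R^N is modelled by a Euclidean space type 'a with N = DIM('a).\<close>
definition C0 :: "('a::euclidean_space \<Rightarrow> real) set" where
  "C0 = {w. continuous_on UNIV w \<and> (w \<longlongrightarrow> 0) at_infinity}"

definition heat_kernel :: "real \<Rightarrow> 'a::euclidean_space \<Rightarrow> real" where
  "heat_kernel s z = (4 * pi * s) powr (- real DIM('a) / 2) * exp (- ((norm z) ^ 2) / (4 * s))"

definition heat_sg :: "real \<Rightarrow> ('a::euclidean_space \<Rightarrow> real) \<Rightarrow> 'a \<Rightarrow> real" where
  "heat_sg s w x = (if s \<le> 0 then w x
     else integral\<^sup>L lborel (\<lambda>y. heat_kernel s (x - y) * w y))"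

text \<open>The Mainardi (Wright-type) function phi_alpha; rGamma is 1/Gamma
  (equal to 0 at the poles of Gamma).\<close>
definition mainardi :: "real \<Rightarrow> real \<Rightarrow> real" where
  "mainardi \<alpha> z = (\<Sum>k. (- z) ^ k / fact k * rGamma (- \<alpha> * real k + 1 - \<alpha>))"

definition P_op :: "real \<Rightarrow> real \<Rightarrow> ('a::euclidean_space \<Rightarrow> real) \<Rightarrow> 'a \<Rightarrow> real" where
  "P_op \<alpha> t w x = (LINT \<theta>:{0..}|lborel. mainardi \<alpha> \<theta> * heat_sg (t powr \<alpha> * \<theta>) w x)"

definition S_op :: "real \<Rightarrow> real \<Rightarrow> ('a::euclidean_space \<Rightarrow> real) \<Rightarrow> 'a \<Rightarrow> real" where
  "S_op \<alpha> t w x = \<alpha> * (LINT \<theta>:{0..}|lborel. \<theta> * mainardi \<alpha> \<theta> * heat_sg (t powr \<alpha> * \<theta>) w x)"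

definition cont_C0_path :: "real \<Rightarrow> (real \<Rightarrow> 'a::euclidean_space \<Rightarrow> real) \<Rightarrow> bool" where
  "cont_C0_path T u \<longleftrightarrow> (\<forall>t\<in>{0..T}. u t \<in> C0) \<and>
     (\<forall>t\<in>{0..T}. \<forall>\<epsilon>>0. \<exists>\<delta>>0. \<forall>s\<in>{0..T}. \<bar>s - t\<bar> < \<delta> \<longrightarrow> (\<forall>x. \<bar>u s x - u t x\<bar> \<le> \<epsilon>))"

definition mild_solution ::
  "real \<Rightarrow> real \<Rightarrow> real \<Rightarrow> real \<Rightarrow> ('a::euclidean_space \<Rightarrow> real) \<Rightarrow> ('a \<Rightarrow> real) \<Rightarrow> real
    \<Rightarrow> (real \<Rightarrow> 'a \<Rightarrow> real) \<Rightarrow> (real \<Rightarrow> 'a \<Rightarrow> real) \<Rightarrow> bool" where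
  "mild_solution \<gamma>1 \<gamma>2 p q u0 v0 T u v \<longleftrightarrow>
     cont_C0_path T u \<and> cont_C0_path T v \<and>
     (\<forall>t\<in>{0..T}. \<forall>x.
        u t x = P_op \<gamma>1 t u0 x +
          (LINT \<tau>:{0..t}|lborel. (t - \<tau>) powr (\<gamma>1 - 1) * S_op \<gamma>1 (t - \<tau>) (\<lambda>y. \<bar>v \<tau> y\<bar> powr p) x)) \<and>
     (\<forall>t\<in>{0..T}. \<forall>x.
        v t x = P_op \<gamma>2 t v0 x +
          (LINT \<tau>:{0..t}|lborel. (t - \<tau>) powr (\<gamma>2 - 1) * S_op \<gamma>2 (t - \<tau>) (\<lambda>y. \<bar>u \<tau> y\<bar> powr q) x))"

definition Tmax ::
  "real \<Rightarrow> real \<Rightarrow> real \<Rightarrow> real \<Rightarrow> ('a::euclidean_space \<Rightarrow> real) \<Rightarrow> ('a \<Rightarrow> real) \<Rightarrow> ereal" where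
  "Tmax \<gamma>1 \<gamma>2 p q u0 v0 =
     (SUP T \<in> {T. T > 0 \<and> (\<exists>u v. mild_solution \<gamma>1 \<gamma>2 p q u0 v0 T u v)}. ereal T)"

end

theory Submission
  imports Defs "HOL-Probability.Distributions" "HOL-Real_Asymp.Real_Asymp"
begin

text \<open>
  For \<open>h \<ge> 1\<close> put \<open>T = h powr (1/\<gamma>1)\<close>. On the ball of radius \<open>sqrt h\<close> a lower bound is preserved, up to a
  constant factor, by the heat semigroup at all times \<open>s \<le> h\<close>, so each Duhamel integral over a window of
  length \<open>\<delta>\<close> with \<open>\<delta> powr \<gamma> \<le> h\<close> turns the bound \<open>m\<close> for \<open>v\<close> into the bound \<open>c * m powr p * \<delta> powr \<gamma>\<close>
  for \<open>u\<close> on the same ball. On \<open>[T/2, T]\<close> the linear part of \<open>u\<close> is at least of order \<open>h powr (-N/2)\<close>.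
  Inserting one equation into the other on time intervals whose left endpoints \<open>T * (1 - 2 powr (-(k+1)))\<close>
  approach \<open>T\<close>, the lower bounds for \<open>u\<close> grow geometrically as soon as a multiple of
  \<open>h powr (1 + p * min 1 (\<gamma>2/\<gamma>1) - N/2 * (p*q - 1))\<close> exceeds a constant. The hypotheses make this exponent
  positive (possibly after exchanging the two equations), so no mild solution survives past \<open>T\<close> for
  \<open>h\<close> large.

  All this needs the Mainardi function to be nonnegative and, together with its first moment, integrable on
  the half-line. With \<open>[x^m]\<close> denoting a Taylor coefficient, it is the limit as \<open>m \<rightarrow> \<infinity>\<close> of
  \<open>m powr \<alpha> * [x^m] ((1 - x) powr (\<alpha> - 1) * exp (- \<theta> * m powr \<alpha> * (1 - x) powr \<alpha>))\<close>. These coefficients are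
  nonnegative since those of \<open>1 - (1 - x) powr \<alpha>\<close> are, and their moments are explicit, so Fatou's lemma applies.
\<close>

unbundle no vec_syntax
unbundle fps_syntax

subsection \<open>Power series of negative powers\<close>

text \<open>The binomial series of \<open>(1 - x) powr (-z)\<close>.\<close>

definition neg_binomial_fps :: "real \<Rightarrow> real fps" where
  "neg_binomial_fps z = Abs_fps (\<lambda>n. pochhammer z n / fact n)"

lemma neg_binomial_fps_nth: "neg_binomial_fps z $ n = pochhammer z n / fact n"
  by (simp add: neg_binomial_fps_def)

lemma neg_binomial_fps_0: "neg_binomial_fps 0 = 1"
  by (simp add: fps_eq_iff neg_binomial_fps_nth pochhammer_0_left)

text \<open>This is the Chu-Vandermonde identity for rising factorials. It makes the series multiply
  like powers of \<open>1 - x\<close>: exponents add.\<close>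

lemma neg_binomial_fps_mult: "neg_binomial_fps a * neg_binomial_fps b = neg_binomial_fps (a + b)"
proof (rule fps_ext)
  fix n
  have "(\<Sum>k\<le>n. real (n choose k) * pochhammer a k * pochhammer b (n - k)) / fact n
      = (\<Sum>k\<le>n. pochhammer a k / fact k * (pochhammer b (n - k) / fact (n - k)))"
    unfolding sum_divide_distrib
    by (intro sum.cong refl) (simp add: binomial_fact field_simps)
  then show "(neg_binomial_fps a * neg_binomial_fps b) $ n = neg_binomial_fps (a + b) $ n"
    by (simp add: fps_mult_nth neg_binomial_fps_nth pochhammer_binomial_sum atLeast0AtMost)
qed

lemma neg_binomial_fps_power: "neg_binomial_fps a ^ k = neg_binomial_fps (real k * a)"
  by (induction k) (simp_all add: neg_binomial_fps_0 neg_binomial_fps_mult algebra_simps)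

lemma neg_binomial_fps_nonneg: "0 \<le> z \<Longrightarrow> 0 \<le> neg_binomial_fps z $ n"
  by (simp add: neg_binomial_fps_nth pochhammer_nonneg pochhammer_prod prod_nonneg)

lemma fps_nonneg_mult:
  fixes f g :: "real fps"
  assumes "\<And>n. 0 \<le> f $ n" "\<And>n. 0 \<le> g $ n"
  shows "0 \<le> (f * g) $ n"
  using assms by (simp add: fps_mult_nth sum_nonneg)

lemma fps_nonneg_power:
  fixes f :: "real fps"
  assumes "\<And>n. 0 \<le> f $ n"
  shows "0 \<le> (f ^ k) $ n"
  by (induction k arbitrary: n) (auto intro!: fps_nonneg_mult assms simp: fps_one_nth)

text \<open>The constant terms cancel. At \<open>k + 1\<close> one factor \<open>-\<alpha>\<close>
  of the rising factorial absorbs the minus sign, and the remaining factors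
  \<open>1 - \<alpha> + i\<close> are positive because \<open>\<alpha> < 1\<close>.\<close>

lemma one_minus_neg_binomial_fps_nonneg:
  assumes "0 < \<alpha>" "\<alpha> < 1"
  shows "0 \<le> (1 - neg_binomial_fps (-\<alpha>)) $ n"
proof (cases n)
  case 0
  then show ?thesis by (simp add: neg_binomial_fps_nth)
next
  case (Suc k)
  have "0 \<le> \<alpha> * pochhammer (1 - \<alpha>) k"
    using assms by (intro mult_nonneg_nonneg) (auto simp: pochhammer_prod intro!: prod_nonneg)
  then show ?thesis
    using Suc by (simp add: neg_binomial_fps_nth pochhammer_rec field_simps)
qed

text \<open>\<open>1 - (1 - x) powr \<alpha>\<close> is the generating function of the Sibuya distribution.\<close>

definition sibuya_coeff :: "real \<Rightarrow> nat \<Rightarrow> nat \<Rightarrow> real" where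
  "sibuya_coeff \<alpha> m j = (neg_binomial_fps (1 - \<alpha>) * (1 - neg_binomial_fps (-\<alpha>)) ^ j) $ m"

lemma sibuya_coeff_nonneg:
  assumes "0 < \<alpha>" "\<alpha> < 1"
  shows "0 \<le> sibuya_coeff \<alpha> m j"
  unfolding sibuya_coeff_def using assms
  by (intro fps_nonneg_mult fps_nonneg_power one_minus_neg_binomial_fps_nonneg neg_binomial_fps_nonneg) auto

section \<open>Sums and binomial expansion of the Sibuya coefficients\<close>

lemma fps_power_mult_nth_eq_0:
  fixes f g :: "real fps"
  assumes "f $ 0 = 0" "m < j"
  shows "(g * f ^ j) $ m = 0"
proof -
  have "(f ^ j) $ i = 0" if "i < j" for i
    using startsby_zero_power_prefix[of f j] assms that by auto
  then show ?thesis using assms by (auto simp: fps_mult_nth)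
qed

lemma sibuya_coeff_eq_0: "m < j \<Longrightarrow> sibuya_coeff \<alpha> m j = 0"
  unfolding sibuya_coeff_def
  by (rule fps_power_mult_nth_eq_0) (simp_all add: neg_binomial_fps_nth)

text \<open>Truncated form of the series for \<open>1 / (1 - g)^2\<close>. Both error terms carry
  powers of \<open>g\<close> beyond \<open>m\<close>, so they do not reach the coefficient at
  \<open>m\<close> once \<open>g\<close> has no constant term.\<close>

lemma sum_Suc_power_telescope:
  fixes g :: "real fps"
  shows "(1 - g)^2 * (\<Sum>j\<le>m. of_nat (Suc j) * g ^ j)
    = 1 - of_nat (m + 2) * g ^ Suc m + of_nat (m + 1) * g ^ (m + 2)"
proof (induction m)
  case 0
  show ?case by (simp add: algebra_simps power2_eq_square)
next
  case (Suc m)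
  have "(1 - g)^2 * (\<Sum>j\<le>Suc m. of_nat (Suc j) * g ^ j)
      = (1 - g)^2 * (\<Sum>j\<le>m. of_nat (Suc j) * g ^ j) + (1 - g)^2 * (of_nat (m + 2) * g ^ Suc m)"
    by (simp add: distrib_left)
  also have "\<dots> = 1 - of_nat (Suc m + 2) * g ^ Suc (Suc m) + of_nat (Suc m + 1) * g ^ (Suc m + 2)"
    unfolding Suc.IH by (simp add: algebra_simps power2_eq_square)
  finally show ?case .
qed

text \<open>For \<open>g = 1 - (1 - x) powr \<alpha>\<close> the geometric series of
  \<open>g\<close> is \<open>(1 - x) powr (-\<alpha>)\<close>. Multiplied by
  \<open>(1 - x) powr (\<alpha> - 1)\<close> it becomes \<open>1 / (1 - x)\<close>, whose
  coefficients are all 1; the powers of \<open>g\<close> beyond \<open>m\<close> do not contribute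
  at degree \<open>m\<close>. These sums are the total masses of the approximants of the Mainardi
  function.\<close>

lemma sum_sibuya_coeff: "(\<Sum>j\<le>m. sibuya_coeff \<alpha> m j) = 1"
proof -
  define g where "g = 1 - neg_binomial_fps (-\<alpha>)"
  have g0: "g $ 0 = 0" by (simp add: g_def neg_binomial_fps_nth)
  have "neg_binomial_fps \<alpha> * (1 - g) = 1"
    by (simp add: g_def neg_binomial_fps_mult neg_binomial_fps_0)
  then have "(\<Sum>j\<le>m. g ^ j) = neg_binomial_fps \<alpha> * ((1 - g) * (\<Sum>j\<le>m. g ^ j))"
    by (simp add: mult.assoc[symmetric])
  also have "\<dots> = neg_binomial_fps \<alpha> - neg_binomial_fps \<alpha> * g ^ Suc m"
    unfolding sum_gp_basic by (simp add: algebra_simps)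
  finally have "neg_binomial_fps (1 - \<alpha>) * (\<Sum>j\<le>m. g ^ j) = neg_binomial_fps 1 - neg_binomial_fps 1 * g ^ Suc m"
    by (simp add: right_diff_distrib neg_binomial_fps_mult mult.assoc[symmetric] del: power_Suc)
  moreover have "(neg_binomial_fps 1 * g ^ Suc m) $ m = 0"
    by (rule fps_power_mult_nth_eq_0) (simp_all add: g0)
  ultimately have "(neg_binomial_fps (1 - \<alpha>) * (\<Sum>j\<le>m. g ^ j)) $ m = neg_binomial_fps 1 $ m"
    by (simp del: power_Suc)
  then show ?thesis
    by (simp add: sibuya_coeff_def g_def[symmetric] sum_distrib_left fps_sum_nth neg_binomial_fps_nth
        pochhammer_fact[symmetric])
qed

text \<open>The same argument with the series for \<open>1 / (1 - g)^2\<close>, which is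
  \<open>(1 - x) powr (-2 * \<alpha>)\<close>. The weight \<open>j + 1\<close> is what the first
  moment of the approximants produces.\<close>

lemma sum_Suc_sibuya_coeff:
  "(\<Sum>j\<le>m. real (Suc j) * sibuya_coeff \<alpha> m j) = neg_binomial_fps (1 + \<alpha>) $ m"
proof -
  define g where "g = 1 - neg_binomial_fps (-\<alpha>)"
  have g0: "g $ 0 = 0" by (simp add: g_def neg_binomial_fps_nth)
  let ?S = "\<Sum>j\<le>m. of_nat (Suc j) * g ^ j"
  have "neg_binomial_fps (2*\<alpha>) * (1 - g)^2 = 1"
    by (simp add: g_def neg_binomial_fps_mult neg_binomial_fps_power neg_binomial_fps_0)
  then have "?S = neg_binomial_fps (2*\<alpha>) * ((1 - g)^2 * ?S)"
    by (simp add: mult.assoc[symmetric] del: of_nat_Suc)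
  also have "\<dots> = neg_binomial_fps (2*\<alpha>) - neg_binomial_fps (2*\<alpha>) * of_nat (m + 2) * g ^ Suc m
      + neg_binomial_fps (2*\<alpha>) * of_nat (m + 1) * g ^ (m + 2)"
    unfolding sum_Suc_power_telescope by (simp add: algebra_simps)
  finally have S: "?S = \<dots>" .
  have "neg_binomial_fps (1 - \<alpha>) * ?S = neg_binomial_fps (1 + \<alpha>) - (neg_binomial_fps (1 + \<alpha>) * of_nat (m + 2)) * g ^ Suc m
      + (neg_binomial_fps (1 + \<alpha>) * of_nat (m + 1)) * g ^ (m + 2)"
    unfolding S
    by (simp only: right_diff_distrib distrib_left neg_binomial_fps_mult mult.assoc[symmetric]) (simp add: add.commute[of 1 \<alpha>])
  moreover have "((neg_binomial_fps (1 + \<alpha>) * of_nat (m + 2)) * g ^ Suc m) $ m = 0"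
       "((neg_binomial_fps (1 + \<alpha>) * of_nat (m + 1)) * g ^ (m + 2)) $ m = 0"
    by (rule fps_power_mult_nth_eq_0; simp add: g0)+
  ultimately have "(neg_binomial_fps (1 - \<alpha>) * ?S) $ m = neg_binomial_fps (1 + \<alpha>) $ m"
    by (simp only: fps_add_nth fps_sub_nth)
  moreover have "(neg_binomial_fps (1 - \<alpha>) * ?S) $ m = (\<Sum>j\<le>m. real (Suc j) * sibuya_coeff \<alpha> m j)"
    unfolding sum_distrib_left fps_sum_nth sibuya_coeff_def g_def[symmetric]
    by (intro sum.cong refl) (simp add: mult.left_commute[of _ "of_nat _"] fps_mult_of_nat_nth del: of_nat_Suc)
  ultimately show ?thesis by simp
qed

text \<open>Rewrites the nonnegative coefficients as the alternating sums that arise when the series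
  of \<open>mainardi_approx\<close> is multiplied by an exponential.\<close>

lemma sibuya_coeff_binomial:
  "sibuya_coeff \<alpha> m j = (\<Sum>i\<le>j. real (j choose i) * (-1)^i * neg_binomial_fps (1 - \<alpha> - \<alpha> * real i) $ m)"
proof -
  have "(1 - neg_binomial_fps (-\<alpha>)) ^ j = (\<Sum>i\<le>j. of_nat (j choose i) * (- neg_binomial_fps (-\<alpha>)) ^ i * 1 ^ (j - i))"
    by (subst binomial_ring[symmetric]) simp
  also have "\<dots> = (\<Sum>i\<le>j. fps_const (real (j choose i) * (-1)^i) * neg_binomial_fps (- \<alpha> * real i))"
    by (intro sum.cong refl, subst power_minus) 
      (simp add: neg_binomial_fps_power mult.commute fps_of_nat[symmetric] fps_const_mult[symmetric]
        fps_const_power[symmetric] fps_const_neg[symmetric] mult_ac del: fps_const_mult fps_const_power fps_const_neg)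
  finally have "neg_binomial_fps (1 - \<alpha>) * (1 - neg_binomial_fps (-\<alpha>)) ^ j
     = (\<Sum>i\<le>j. fps_const (real (j choose i) * (-1)^i) * (neg_binomial_fps (1 - \<alpha>) * neg_binomial_fps (- \<alpha> * real i)))"
    by (simp add: sum_distrib_left mult.left_commute)
  then show ?thesis
    by (simp add: sibuya_coeff_def neg_binomial_fps_mult fps_sum_nth)
qed

section \<open>Uniform bounds and limits of the scaled binomial coefficients\<close>

lemma neg_binomial_fps_prod: "neg_binomial_fps (1 - b) $ m = (\<Prod>i=1..m. 1 - b / real i)"
proof (induction m)
  case (Suc m)
  have "neg_binomial_fps (1 - b) $ Suc m = neg_binomial_fps (1 - b) $ m * ((1 - b + real m) / real (Suc m))"
    by (simp add: neg_binomial_fps_nth pochhammer_rec' field_simps)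
  also have "(1 - b + real m) / real (Suc m) = 1 - b / real (Suc m)"
    by (simp add: field_simps)
  finally show ?case using Suc by simp
qed (simp add: neg_binomial_fps_nth)

lemma harm_le_ln: "harm n \<le> 1 + ln (real n + 1)"
proof -
  have *: "harm (Suc n) \<le> 1 + ln (real (Suc n))" for n
  proof (induction n)
    case (Suc n)
    have "ln (real (Suc n) / real (Suc (Suc n))) \<le> real (Suc n) / real (Suc (Suc n)) - 1"
      by (rule ln_le_minus_one) simp
    also have "\<dots> = - inverse (real (Suc (Suc n)))" by (simp add: field_simps)
    finally have "inverse (real (Suc (Suc n))) \<le> ln (real (Suc (Suc n))) - ln (real (Suc n))"
      by (simp add: ln_div)
    then show ?case using Suc by (subst harm_Suc) (simp del: of_nat_Suc)
  qed (simp add: harm_expand)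
  show ?thesis
  proof (cases n)
    case 0 then show ?thesis by (simp add: harm_expand)
  next
    case (Suc k)
    have "ln (real (Suc k)) \<le> ln (real (Suc k) + 1)" by (subst ln_le_cancel_iff) auto
    then show ?thesis using *[of k] unfolding Suc by linarith
  qed
qed

text \<open>A factor with \<open>i > b\<close> is at most 1, since
  \<open>(1 - x) * exp x \<le> 1\<close> on the unit interval, so the product can only grow up to
  \<open>n\<close>, the integer part of \<open>b\<close>. There
  \<open>\<bar>1 - b / i\<bar> \<le> b / i\<close>, and the product is at most
  \<open>b ^ m / fact m * exp (b * harm m)\<close>, where the first quotient is a single term of the
  series of \<open>exp b\<close>. The bound is independent of \<open>m\<close>.\<close>

lemma prod_exp_bound:
  assumes "0 < b"
  shows "(\<Prod>i=1..m. \<bar>1 - b / real i\<bar> * exp (b / real i)) \<le> exp (b * (2 + ln (b + 1)))"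
proof -
  define n where "n = nat \<lfloor>b\<rfloor>"
  define P where "P m = (\<Prod>i=1..m. \<bar>1 - b / real i\<bar> * exp (b / real i))" for m
  define E where "E = exp (b * (2 + ln (b + 1)))"
  have n: "real n \<le> b" "b < real n + 1" using assms by (auto simp: n_def)
  have P0: "0 \<le> P m" for m by (auto simp: P_def intro!: prod_nonneg)
  have small: "P m \<le> E" if "m \<le> n" for m
  proof -
    have "P m \<le> (\<Prod>i=1..m. (b / real i) * exp (b / real i))"
      unfolding P_def
    proof (intro prod_mono conjI mult_right_mono)
      fix i assume "i \<in> {1..m}"
      then have "1 \<le> b / real i" using n that by (auto simp: field_simps)
      then show "\<bar>1 - b / real i\<bar> \<le> b / real i" by simp
    qed auto
    also have "\<dots> = (b ^ m / fact m) * exp (b * harm m)"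
      by (simp add: prod.distrib exp_sum[symmetric] harm_def sum_distrib_left divide_inverse
          prod_dividef[unfolded divide_inverse] fact_prod prod_inversef power_inverse flip: prod_inversef)
    also have "\<dots> \<le> exp b * exp (b * (1 + ln (b + 1)))"
    proof (intro mult_mono)
      have "b ^ m / fact m = (\<Sum>k\<in>{m}. b ^ k /\<^sub>R fact k)" by (simp add: divide_inverse)
      also have "\<dots> \<le> exp b" unfolding exp_def
        using assms by (intro sum_le_suminf summable_exp_generic) auto
      finally show "b ^ m / fact m \<le> exp b" .
      have "harm m \<le> 1 + ln (real m + 1)" by (rule harm_le_ln)
      also have "\<dots> \<le> 1 + ln (b + 1)" using that n assms by (simp add: ln_le_cancel_iff)
      finally show "exp (b * harm m) \<le> exp (b * (1 + ln (b + 1)))" using assms by simp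
    qed (use assms in auto)
    also have "\<dots> = E" by (simp add: E_def exp_add[symmetric] algebra_simps)
    finally show ?thesis .
  qed
  have "P m \<le> E"
  proof (induction m)
    case 0
    show ?case by (rule small) simp
  next
    case (Suc m)
    show ?case
    proof (cases "Suc m \<le> n")
      case True then show ?thesis by (rule small)
    next
      case False
      define x where "x = b / real (Suc m)"
      have x: "0 \<le> x" "x \<le> 1" using False n assms by (auto simp: field_simps x_def)
      have "(1 - x) * exp x \<le> exp (- x) * exp x"
        using exp_ge_add_one_self[of "-x"] by (intro mult_right_mono) auto
      then have "\<bar>1 - x\<bar> * exp x \<le> 1" using x by (simp add: exp_minus)
      then have "P m * (\<bar>1 - x\<bar> * exp x) \<le> P m" using P0[of m] by (simp add: mult_left_le)
      moreover have "P (Suc m) = P m * (\<bar>1 - x\<bar> * exp x)" by (simp add: P_def x_def)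
      ultimately show ?thesis using Suc by linarith
    qed
  qed
  then show ?thesis by (simp add: P_def E_def)
qed

text \<open>Since \<open>ln m \<le> harm m\<close>, the weight \<open>m powr b\<close> is dominated
  by the product of the \<open>exp (b / i)\<close>, which can be distributed over the factors
  \<open>1 - b / i\<close>.\<close>

lemma powr_neg_binomial_fps_bound:
  assumes "0 < b" "0 < m"
  shows "\<bar>real m powr b * neg_binomial_fps (1 - b) $ m\<bar> \<le> exp (b * (2 + ln (b + 1)))"
proof -
  have "real m powr b \<le> exp (b * harm m)"
  proof -
    have "ln (real m) \<le> ln (real m + 1)" using assms by simp
    also have "\<dots> \<le> harm m" by (rule ln_le_harm)
    finally show ?thesis using assms by (simp add: powr_def)
  qed
  also have "\<dots> = (\<Prod>i=1..m. exp (b / real i))"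
    by (simp add: exp_sum[symmetric] harm_def sum_distrib_left divide_inverse)
  finally have "real m powr b * (\<Prod>i=1..m. \<bar>1 - b / real i\<bar>)
     \<le> (\<Prod>i=1..m. exp (b / real i)) * (\<Prod>i=1..m. \<bar>1 - b / real i\<bar>)"
    by (intro mult_right_mono prod_nonneg) auto
  also have "\<dots> \<le> exp (b * (2 + ln (b + 1)))"
    using prod_exp_bound[OF assms(1), of m] by (simp add: prod.distrib mult.commute)
  finally show ?thesis by (simp add: neg_binomial_fps_prod abs_mult abs_prod)
qed

text \<open>Euler's product for the reciprocal Gamma function. \<open>rGamma_series\<close> uses a
  rising factorial with one more factor, which the quotient \<open>m / (1 - b + m)\<close>, tending
  to 1, removes.\<close>

lemma powr_neg_binomial_fps_LIMSEQ: "(\<lambda>m. real m powr b * neg_binomial_fps (1 - b) $ m) \<longlonglongrightarrow> rGamma (1 - b)"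
proof -
  have "(\<lambda>m. rGamma_series (1 - b) m * (real m / (1 - b + real m))) \<longlonglongrightarrow> rGamma (1 - b) * 1"
    by (intro tendsto_mult rGamma_series_LIMSEQ) real_asymp
  moreover have "\<forall>\<^sub>F m in sequentially. rGamma_series (1 - b) m * (real m / (1 - b + real m))
      = real m powr b * neg_binomial_fps (1 - b) $ m"
    using eventually_gt_at_top[of "nat \<lceil>\<bar>b\<bar>\<rceil>"]
  proof eventually_elim
    case (elim m)
    then have m: "\<bar>b\<bar> < real m" by linarith
    define P where "P = pochhammer (1 - b) m"
    have nz: "1 - b + real m \<noteq> 0" "real m \<noteq> 0" using m by linarith+
    have e: "exp ((1 - b) * ln (real m)) = real m / real m powr b"
      using m by (simp add: powr_def left_diff_distrib exp_diff)
    have "rGamma_series (1 - b) m = (1 - b + real m) * P / (fact m * (real m / real m powr b))"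
      using e by (simp add: rGamma_series_def pochhammer_rec' P_def)
    then show ?case
      using nz unfolding neg_binomial_fps_nth P_def[symmetric] by (simp add: divide_simps mult_ac)
  qed
  ultimately show ?thesis by (auto intro: Lim_transform_eventually)
qed

text \<open>The bound of \<open>powr_neg_binomial_fps_bound\<close> at
  \<open>b = \<alpha> * (k + 1)\<close>.\<close>

definition wright_majorant :: "real \<Rightarrow> nat \<Rightarrow> real" where
  "wright_majorant \<alpha> k = exp ((\<alpha> * (real k + 1)) * (2 + ln (\<alpha> * (real k + 1) + 1)))"

text \<open>The majorant grows like \<open>k powr (\<alpha> * k)\<close> up to exponential factors.
  Consecutive terms therefore have a quotient of order at most \<open>k powr (\<alpha> - 1)\<close>,
  which tends to 0 because \<open>\<alpha> < 1\<close>.\<close>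

lemma summable_wright_majorant:
  assumes "0 < \<alpha>" "\<alpha> < 1"
  shows "summable (\<lambda>k. x ^ k / fact k * wright_majorant \<alpha> k)"
proof -
  define b where "b k = \<alpha> * (real k + 1)" for k :: nat
  define r where "r k = \<bar>x\<bar> / (real k + 1) * exp (b (Suc k) * (2 + ln (b (Suc k) + 1)) - b k * (2 + ln (b k + 1)))" for k
  have "r \<longlonglongrightarrow> 0"
    unfolding r_def b_def using assms by real_asymp
  then have "\<forall>\<^sub>F k in sequentially. r k < 1/2"
    by (rule order_tendstoD) simp
  then obtain K where K: "\<And>k. k \<ge> K \<Longrightarrow> r k \<le> 1/2"
    by (auto simp: eventually_sequentially intro: less_imp_le)
  show ?thesis
  proof (rule summable_ratio_test[where c = "1/2" and N = K])
    fix k assume "K \<le> k"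
    let ?f = "\<lambda>k. x ^ k / fact k * wright_majorant \<alpha> k"
    have "norm (?f (Suc k)) = r k * norm (?f k)"
      by (simp add: wright_majorant_def r_def b_def exp_diff abs_mult power_abs add_ac)
    also have "\<dots> \<le> 1/2 * norm (?f k)"
      using K[OF \<open>K \<le> k\<close>] by (intro mult_right_mono) auto
    finally show "norm (?f (Suc k)) \<le> 1/2 * norm (?f k)" .
  qed simp
qed

subsection \<open>The Mainardi function\<close>

text \<open>The series of the Mainardi function with each \<open>rGamma (1 - b)\<close> replaced by
  the \<open>m\<close>-th term of the sequence in \<open>powr_neg_binomial_fps_LIMSEQ\<close>;
  equivalently, the coefficient formula of the introduction with its exponential expanded in powers
  of \<open>\<theta>\<close>.\<close>

definition mainardi_approx :: "real \<Rightarrow> nat \<Rightarrow> real \<Rightarrow> real" where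
  "mainardi_approx \<alpha> m \<theta> = (\<Sum>k. (- \<theta>) ^ k / fact k *
      (real m powr (\<alpha> * (real k + 1)) * neg_binomial_fps (1 - \<alpha> * (real k + 1)) $ m))"

lemma mainardi_altdef:
  "mainardi \<alpha> \<theta> = (\<Sum>k. (- \<theta>) ^ k / fact k * rGamma (1 - \<alpha> * (real k + 1)))"
  unfolding mainardi_def by (simp add: algebra_simps)

lemma norm_mainardi_approx_term:
  assumes "0 < \<alpha>" "0 < m"
  shows "norm ((- \<theta>) ^ k / fact k * (real m powr (\<alpha> * (real k + 1)) * neg_binomial_fps (1 - \<alpha> * (real k + 1)) $ m))
      \<le> \<bar>\<theta>\<bar> ^ k / fact k * wright_majorant \<alpha> k"
  using powr_neg_binomial_fps_bound[of "\<alpha> * (real k + 1)" m] assms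
  by (auto simp: abs_mult power_abs wright_majorant_def intro!: mult_left_mono divide_right_mono)

text \<open>Tannery's theorem: every term converges, and \<open>wright_majorant\<close> dominates
  the terms uniformly in \<open>m \<ge> 1\<close>. The second conclusion says that the power series
  of \<open>mainardi\<close> converges everywhere.\<close>

lemma mainardi_approx_LIMSEQ:
  assumes "0 < \<alpha>" "\<alpha> < 1"
  shows "(\<lambda>m. mainardi_approx \<alpha> m \<theta>) \<longlonglongrightarrow> mainardi \<alpha> \<theta>"
    and "summable (\<lambda>k. norm ((- \<theta>) ^ k / fact k * rGamma (1 - \<alpha> * (real k + 1))))"
proof -
  let ?a = "\<lambda>k m. (- \<theta>) ^ k / fact k * (real m powr (\<alpha> * (real k + 1)) * neg_binomial_fps (1 - \<alpha> * (real k + 1)) $ m)"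
  let ?b = "\<lambda>k. (- \<theta>) ^ k / fact k * rGamma (1 - \<alpha> * (real k + 1))"
  have "eventually (\<lambda>m. summable (\<lambda>k. norm (?a k m))) sequentially \<and> summable (\<lambda>k. norm (?b k)) \<and>
      (\<lambda>m. suminf (\<lambda>k. ?a k m)) \<longlonglongrightarrow> suminf ?b"
  proof (rule tannerys_theorem)
    show "(\<lambda>m. ?a k m) \<longlonglongrightarrow> ?b k" for k
      by (intro tendsto_mult_left powr_neg_binomial_fps_LIMSEQ)
    show "\<forall>\<^sub>F (k, m) in sequentially \<times>\<^sub>F sequentially. norm (?a k m) \<le> \<bar>\<theta>\<bar> ^ k / fact k * wright_majorant \<alpha> k"
      unfolding eventually_prod_sequentially case_prod_conv
      by (intro exI[of _ 1] allI impI norm_mainardi_approx_term assms) auto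
    show "summable (\<lambda>k. \<bar>\<theta>\<bar> ^ k / fact k * wright_majorant \<alpha> k)"
      by (rule summable_wright_majorant) fact+
  qed simp
  then show "(\<lambda>m. mainardi_approx \<alpha> m \<theta>) \<longlonglongrightarrow> mainardi \<alpha> \<theta>"
      "summable (\<lambda>k. norm (?b k))"
    unfolding mainardi_approx_def mainardi_altdef by auto
qed

lemma isCont_mainardi:
  assumes "0 < \<alpha>" "\<alpha> < 1"
  shows "isCont (mainardi \<alpha>) \<theta>"
proof -
  define c where "c k = (-1) ^ k / fact k * rGamma (1 - \<alpha> * (real k + 1))" for k :: nat
  have eq: "mainardi \<alpha> = (\<lambda>x. \<Sum>k. c k * x ^ k)"
  proof
    fix x
    show "mainardi \<alpha> x = (\<Sum>k. c k * x ^ k)"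
      by (simp add: mainardi_altdef c_def power_minus[of x] mult_ac)
  qed
  have "summable (\<lambda>k. c k * (\<bar>\<theta>\<bar> + 1) ^ k)"
    using summable_norm_cancel[OF mainardi_approx_LIMSEQ(2)[OF assms, of "\<bar>\<theta>\<bar> + 1"]]
    by (simp add: c_def power_minus[of "\<bar>\<theta>\<bar> + 1"] mult_ac del: minus_add_distrib)
  then show ?thesis unfolding eq by (rule isCont_powser) simp
qed

lemma mainardi_0: "mainardi \<alpha> 0 = rGamma (1 - \<alpha>)"
proof -
  have "mainardi \<alpha> 0 = (\<Sum>k\<in>{0}. (- 0) ^ k / fact k * rGamma (1 - \<alpha> * (real k + 1)))"
    unfolding mainardi_altdef by (rule suminf_finite) auto
  then show ?thesis by simp
qed

text \<open>Makes positivity visible. With \<open>x = \<theta> * L\<close>, the Cauchy product of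
  \<open>exp x\<close> with the alternating series has the Sibuya coefficients as its binomial sums.
  In generating functions, \<open>exp (-x * (1 - z) powr \<alpha>)\<close> is
  \<open>exp (-x)\<close> times \<open>exp (x * (1 - (1 - z) powr \<alpha>))\<close>. The sum stops
  at \<open>m\<close> because later coefficients vanish.\<close>

lemma mainardi_approx_eq:
  assumes "0 < \<alpha>" "\<alpha> < 1" "0 < m"
  defines "L \<equiv> real m powr \<alpha>"
  shows "mainardi_approx \<alpha> m \<theta>
     = L * exp (- (\<theta> * L)) * (\<Sum>j\<le>m. (\<theta> * L) ^ j / fact j * sibuya_coeff \<alpha> m j)"
proof -
  define x where "x = \<theta> * L"
  define c where "c k = neg_binomial_fps (1 - \<alpha> * (real k + 1)) $ m" for k
  have L: "real m powr (\<alpha> * (real k + 1)) = L * L ^ k" for k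
    using assms by (simp add: L_def distrib_left powr_add powr_powr[symmetric] powr_realpow)
  have tm: "(- \<theta>) ^ k / fact k * (real m powr (\<alpha> * (real k + 1)) * c k) = L * ((- x) ^ k / fact k * c k)" for k
    by (simp add: L x_def power_mult_distrib power_minus[of "\<theta> * L"] power_minus[of \<theta>])
  have "summable (\<lambda>k. norm (L * ((- x) ^ k / fact k * c k)))"
    using norm_mainardi_approx_term[OF assms(1,3), of \<theta>]
    by (intro summable_comparison_test'[OF summable_wright_majorant[OF assms(1,2), of "\<bar>\<theta>\<bar>"], of 0])
       (auto simp only: tm c_def[symmetric] real_norm_def abs_abs)
  moreover have "L \<noteq> 0" using assms by (simp add: L_def)
  ultimately have sm: "summable (\<lambda>k. norm ((- x) ^ k / fact k * c k))"
    by (simp only: norm_mult summable_cmult_iff norm_eq_zero) simp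
  have "exp x * (\<Sum>k. (- x) ^ k / fact k * c k) = (\<Sum>k. x ^ k / fact k) * (\<Sum>k. (- x) ^ k / fact k * c k)"
    by (simp add: exp_def divide_inverse mult.commute)
  also have "\<dots> = (\<Sum>j. \<Sum>i\<le>j. x ^ i / fact i * ((- x) ^ (j - i) / fact (j - i) * c (j - i)))"
    using summable_norm_exp[of x] sm
    by (intro Cauchy_product) (simp_all add: divide_inverse mult.commute)
  also have "\<dots> = (\<Sum>j. x ^ j / fact j * sibuya_coeff \<alpha> m j)"
  proof (rule suminf_cong)
    fix j
    have "(\<Sum>i\<le>j. x ^ i / fact i * ((- x) ^ (j - i) / fact (j - i) * c (j - i)))
        = (\<Sum>i\<le>j. x ^ (j - i) / fact (j - i) * ((- x) ^ i / fact i * c i))"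
      by (rule sum.reindex_bij_witness[of _ "\<lambda>i. j - i" "\<lambda>i. j - i"]) auto
    also have "\<dots> = (\<Sum>i\<le>j. x ^ j / fact j * (real (j choose i) * (-1)^i * c i))"
    proof (intro sum.cong refl)
      fix i assume "i \<in> {..j}"
      then have "x ^ (j - i) * x ^ i = x ^ j" "real (j choose i) = fact j / (fact i * fact (j - i))"
        by (auto simp: power_add[symmetric] binomial_fact)
      then show "x ^ (j - i) / fact (j - i) * ((- x) ^ i / fact i * c i)
          = x ^ j / fact j * (real (j choose i) * (-1)^i * c i)"
        by (simp add: power_minus[of x] field_simps)
    qed
    also have "\<dots> = x ^ j / fact j * sibuya_coeff \<alpha> m j"
      unfolding sibuya_coeff_binomial sum_distrib_left c_def by (simp add: algebra_simps)
    finally show "(\<Sum>i\<le>j. x ^ i / fact i * ((- x) ^ (j - i) / fact (j - i) * c (j - i)))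
        = x ^ j / fact j * sibuya_coeff \<alpha> m j" .
  qed
  also have "\<dots> = (\<Sum>j\<le>m. x ^ j / fact j * sibuya_coeff \<alpha> m j)"
    by (rule suminf_finite) (auto intro: sibuya_coeff_eq_0)
  finally have *: "(\<Sum>k. (- x) ^ k / fact k * c k) = exp (- x) * (\<Sum>j\<le>m. x ^ j / fact j * sibuya_coeff \<alpha> m j)"
    by (simp add: exp_minus field_simps)
  have "mainardi_approx \<alpha> m \<theta> = L * (\<Sum>k. (- x) ^ k / fact k * c k)"
    unfolding mainardi_approx_def c_def[symmetric] tm
    by (rule suminf_mult) (rule summable_norm_cancel[OF sm])
  then show ?thesis unfolding * by (simp only: x_def mult.assoc)
qed

lemma mainardi_approx_nonneg:
  assumes "0 < \<alpha>" "\<alpha> < 1" "0 < m" "0 \<le> \<theta>"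
  shows "0 \<le> mainardi_approx \<alpha> m \<theta>"
  unfolding mainardi_approx_eq[OF assms(1-3)] using assms
  by (intro mult_nonneg_nonneg sum_nonneg divide_nonneg_nonneg sibuya_coeff_nonneg) auto

lemma mainardi_nonneg:
  assumes "0 < \<alpha>" "\<alpha> < 1" "0 \<le> \<theta>"
  shows "0 \<le> mainardi \<alpha> \<theta>"
proof (rule LIMSEQ_le_const[OF mainardi_approx_LIMSEQ(1)[OF assms(1,2)]])
  show "\<exists>N. \<forall>m\<ge>N. 0 \<le> mainardi_approx \<alpha> m \<theta>"
    using mainardi_approx_nonneg[OF assms(1,2) _ assms(3)] by (intro exI[of _ 1]) auto
qed

section \<open>Moments of the Mainardi function\<close>

lemma nn_integral_power_exp_scaled:
  assumes "0 < L"
  shows "(\<integral>\<^sup>+\<theta>. ennreal (\<theta> ^ k * exp (- (\<theta> * L))) * indicator {0..} \<theta> \<partial>lborel) = ennreal (fact k / L ^ (k + 1))"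
proof -
  have "ennreal (fact k) = (\<integral>\<^sup>+x. ennreal (x ^ k * exp (- x)) * indicator {0..} x \<partial>lborel)"
    by (subst nn_intergal_power_times_exp_Ici) (simp add: ennreal_of_nat_eq_real_of_nat)
  also have "\<dots> = ennreal L * (\<integral>\<^sup>+\<theta>. ennreal ((L * \<theta>) ^ k * exp (- (L * \<theta>))) * indicator {0..} (L * \<theta>) \<partial>lborel)"
    using nn_integral_real_affine[of "\<lambda>x. ennreal (x ^ k * exp (- x)) * indicator {0..} x" L 0] assms by simp
  also have "(\<integral>\<^sup>+\<theta>. ennreal ((L * \<theta>) ^ k * exp (- (L * \<theta>))) * indicator {0..} (L * \<theta>) \<partial>lborel)
     = (\<integral>\<^sup>+\<theta>. ennreal (L ^ k) * (ennreal (\<theta> ^ k * exp (- (\<theta> * L))) * indicator {0..} \<theta>) \<partial>lborel)"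
    using assms by (intro nn_integral_cong)
      (auto simp: indicator_def zero_le_mult_iff power_mult_distrib ennreal_mult'[symmetric] mult_ac)
  also have "\<dots> = ennreal (L ^ k) * (\<integral>\<^sup>+\<theta>. ennreal (\<theta> ^ k * exp (- (\<theta> * L))) * indicator {0..} \<theta> \<partial>lborel)"
    by (rule nn_integral_cmult) measurable
  finally have *: "ennreal (fact k) = ennreal (L ^ (k+1)) * (\<integral>\<^sup>+\<theta>. ennreal (\<theta> ^ k * exp (- (\<theta> * L))) * indicator {0..} \<theta> \<partial>lborel)"
    using assms by (simp add: mult.assoc[symmetric] ennreal_mult''[symmetric])
  have "ennreal (fact k / L ^ (k + 1)) = ennreal (inverse (L ^ (k+1))) * ennreal (fact k)"
    using assms by (simp add: ennreal_mult'[symmetric] divide_inverse mult.commute)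
  also have "\<dots> = ennreal (inverse (L ^ (k+1)) * L ^ (k+1)) * (\<integral>\<^sup>+\<theta>. ennreal (\<theta> ^ k * exp (- (\<theta> * L))) * indicator {0..} \<theta> \<partial>lborel)"
    unfolding * using assms by (simp add: mult.assoc[symmetric] ennreal_mult'[symmetric])
  also have "inverse (L ^ (k+1)) * L ^ (k+1) = 1" using assms by (intro left_inverse) auto
  finally show ?thesis by simp
qed

text \<open>Each term of \<open>mainardi_approx_eq\<close> integrates to a Gamma integral. The
  factorials leave \<open>fact (j + n) / fact j\<close>, and all powers of \<open>L\<close> cancel
  except \<open>L\<close> to the power \<open>-n\<close>.\<close>

lemma nn_integral_mainardi_approx:
  assumes "0 < \<alpha>" "\<alpha> < 1" "0 < m"
  shows "(\<integral>\<^sup>+\<theta>. ennreal (\<theta> ^ n * mainardi_approx \<alpha> m \<theta>) * indicator {0..} \<theta> \<partial>lborel)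
    = ennreal (real m powr (- \<alpha> * n) * (\<Sum>j\<le>m. fact (j + n) / fact j * sibuya_coeff \<alpha> m j))"
proof -
  define L where "L = real m powr \<alpha>"
  have L: "0 < L" using assms by (simp add: L_def)
  define c where "c j = L * L ^ j / fact j * sibuya_coeff \<alpha> m j" for j
  have c: "0 \<le> c j" for j
    using L sibuya_coeff_nonneg[OF assms(1,2)] by (simp add: c_def)
  have "(\<integral>\<^sup>+\<theta>. ennreal (\<theta> ^ n * mainardi_approx \<alpha> m \<theta>) * indicator {0..} \<theta> \<partial>lborel)
     = (\<integral>\<^sup>+\<theta>. (\<Sum>j\<le>m. ennreal (c j) * (ennreal (\<theta> ^ (j + n) * exp (- (\<theta> * L))) * indicator {0..} \<theta>)) \<partial>lborel)"
  proof (intro nn_integral_cong)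
    fix \<theta> :: real
    have "\<theta> ^ n * mainardi_approx \<alpha> m \<theta> = (\<Sum>j\<le>m. c j * (\<theta> ^ (j + n) * exp (- (\<theta> * L))))"
      unfolding mainardi_approx_eq[OF assms] L_def[symmetric] sum_distrib_left c_def
      by (intro sum.cong refl) (simp add: power_add power_mult_distrib)
    moreover have "ennreal (\<Sum>j\<le>m. c j * (\<theta> ^ (j + n) * exp (- (\<theta> * L))))
        = (\<Sum>j\<le>m. ennreal (c j) * ennreal (\<theta> ^ (j + n) * exp (- (\<theta> * L))))" if "0 \<le> \<theta>"
      using that c by (subst sum_ennreal[symmetric]) (auto simp: ennreal_mult')
    ultimately show "ennreal (\<theta> ^ n * mainardi_approx \<alpha> m \<theta>) * indicator {0..} \<theta>
      = (\<Sum>j\<le>m. ennreal (c j) * (ennreal (\<theta> ^ (j + n) * exp (- (\<theta> * L))) * indicator {0..} \<theta>))"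
      by (cases "0 \<le> \<theta>") (auto simp: sum_distrib_right mult.assoc)
  qed
  also have "\<dots> = (\<Sum>j\<le>m. ennreal (c j) * ennreal (fact (j + n) / L ^ (j + n + 1)))"
    by (subst nn_integral_sum) (auto simp: nn_integral_cmult nn_integral_power_exp_scaled[OF L])
  also have "\<dots> = ennreal (\<Sum>j\<le>m. c j * (fact (j + n) / L ^ (j + n + 1)))"
  proof -
    have "ennreal (c j) * ennreal (fact (j + n) / L ^ (j + n + 1)) = ennreal (c j * (fact (j + n) / L ^ (j + n + 1)))" for j
      using c by (rule ennreal_mult'[symmetric])
    moreover have "0 \<le> c j * (fact (j + n) / L ^ (j + n + 1))" for j
      using c[of j] L by (intro mult_nonneg_nonneg divide_nonneg_pos) auto
    ultimately show ?thesis by (simp only: sum_ennreal)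
  qed
  also have "(\<Sum>j\<le>m. c j * (fact (j + n) / L ^ (j + n + 1)))
      = real m powr (- \<alpha> * n) * (\<Sum>j\<le>m. fact (j + n) / fact j * sibuya_coeff \<alpha> m j)"
    unfolding sum_distrib_left
  proof (intro sum.cong refl)
    fix j
    have "real m powr (- \<alpha> * n) = inverse (L ^ n)"
      using assms by (simp add: L_def powr_minus powr_powr[symmetric] powr_realpow)
    then show "c j * (fact (j + n) / L ^ (j + n + 1)) = real m powr (- \<alpha> * n) * (fact (j + n) / fact j * sibuya_coeff \<alpha> m j)"
      using L by (simp add: c_def power_add field_simps)
  qed
  finally show ?thesis .
qed

lemma borel_measurable_mainardi:
  assumes "0 < \<alpha>" "\<alpha> < 1"
  shows "mainardi \<alpha> \<in> borel_measurable borel"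
  using isCont_mainardi[OF assms] by (intro borel_measurable_continuous_onI) (simp add: continuous_on_eq_continuous_within continuous_at_imp_continuous_at_within)

text \<open>Fatou's lemma along the approximants. The index is shifted to \<open>Suc m\<close>
  because the closed form and the moment formula require a positive index.\<close>

lemma nn_integral_mainardi_le:
  assumes "0 < \<alpha>" "\<alpha> < 1"
    and lim: "(\<lambda>m. real m powr (- \<alpha> * n) * (\<Sum>j\<le>m. fact (j + n) / fact j * sibuya_coeff \<alpha> m j)) \<longlonglongrightarrow> C"
  shows "(\<integral>\<^sup>+\<theta>. ennreal (\<theta> ^ n * mainardi \<alpha> \<theta>) * indicator {0..} \<theta> \<partial>lborel) \<le> ennreal C"
proof -
  let ?f = "\<lambda>m \<theta>. ennreal (\<theta> ^ n * mainardi_approx \<alpha> m \<theta>) * indicator {0..} \<theta>"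
  have [measurable]: "mainardi_approx \<alpha> (Suc m) \<in> borel_measurable borel" for m
  proof -
    have "mainardi_approx \<alpha> (Suc m) = (\<lambda>\<theta>. real (Suc m) powr \<alpha> * exp (- (\<theta> * real (Suc m) powr \<alpha>))
        * (\<Sum>j\<le>Suc m. (\<theta> * real (Suc m) powr \<alpha>) ^ j / fact j * sibuya_coeff \<alpha> (Suc m) j))"
      by (intro ext mainardi_approx_eq assms) simp
    then show ?thesis by (simp only:) measurable
  qed
  have "(\<integral>\<^sup>+\<theta>. ennreal (\<theta> ^ n * mainardi \<alpha> \<theta>) * indicator {0..} \<theta> \<partial>lborel)
     = (\<integral>\<^sup>+\<theta>. liminf (\<lambda>m. ?f (Suc m) \<theta>) \<partial>lborel)"
  proof (intro nn_integral_cong lim_imp_Liminf[symmetric])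
    fix \<theta> :: real
    have "(\<lambda>m. ennreal (\<theta> ^ n * mainardi_approx \<alpha> (Suc m) \<theta>)) \<longlonglongrightarrow> ennreal (\<theta> ^ n * mainardi \<alpha> \<theta>)"
      by (intro tendsto_intros LIMSEQ_Suc mainardi_approx_LIMSEQ assms)
    then show "(\<lambda>m. ?f (Suc m) \<theta>) \<longlonglongrightarrow> ennreal (\<theta> ^ n * mainardi \<alpha> \<theta>) * indicator {0..} \<theta>"
      by (cases "0 \<le> \<theta>") auto
  qed simp
  also have "\<dots> \<le> liminf (\<lambda>m. \<integral>\<^sup>+\<theta>. ?f (Suc m) \<theta> \<partial>lborel)"
    by (intro nn_integral_liminf) measurable
  also have "\<dots> = ennreal C"
    unfolding nn_integral_mainardi_approx[OF assms(1,2) zero_less_Suc]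
    by (intro lim_imp_Liminf tendsto_ennrealI LIMSEQ_Suc[OF lim]) simp
  finally show ?thesis .
qed

lemma set_integrable_mainardi:
  assumes "0 < \<alpha>" "\<alpha> < 1"
  shows "set_integrable lborel {0..} (mainardi \<alpha>)"
    and "set_integrable lborel {0..} (\<lambda>\<theta>. \<theta> * mainardi \<alpha> \<theta>)"
proof -
  note [measurable] = borel_measurable_mainardi[OF assms]
  have *: "set_integrable lborel {0..} (\<lambda>\<theta>. \<theta> ^ n * mainardi \<alpha> \<theta>)"
    if "(\<integral>\<^sup>+\<theta>. ennreal (\<theta> ^ n * mainardi \<alpha> \<theta>) * indicator {0..} \<theta> \<partial>lborel) \<le> ennreal C" for n C
    unfolding set_integrable_def
  proof (rule integrableI_nonneg)
    show "AE \<theta> in lborel. 0 \<le> indicator {0..} \<theta> *\<^sub>R (\<theta> ^ n * mainardi \<alpha> \<theta>)"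
      using mainardi_nonneg[OF assms] by (intro AE_I2) (auto simp: indicator_def)
    have "(\<integral>\<^sup>+\<theta>. ennreal (indicator {0..} \<theta> *\<^sub>R (\<theta> ^ n * mainardi \<alpha> \<theta>)) \<partial>lborel)
       = (\<integral>\<^sup>+\<theta>. ennreal (\<theta> ^ n * mainardi \<alpha> \<theta>) * indicator {0..} \<theta> \<partial>lborel)"
      by (intro nn_integral_cong) (auto simp: indicator_def)
    also have "\<dots> < \<infinity>" using that by (rule order_le_less_trans) simp
    finally show "(\<integral>\<^sup>+\<theta>. ennreal (indicator {0..} \<theta> *\<^sub>R (\<theta> ^ n * mainardi \<alpha> \<theta>)) \<partial>lborel) < \<infinity>" .
  qed measurable
  \<comment> \<open>The sequence equals 1 only for \<open>m > 0\<close>: at \<open>m = 0\<close> the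
    convention \<open>0 powr 0 = 0\<close> makes it 0.\<close>
  have "(\<lambda>m. real m powr (- \<alpha> * real 0) * (\<Sum>j\<le>m. fact (j + 0) / fact j * sibuya_coeff \<alpha> m j)) \<longlonglongrightarrow> 1"
    by (rule tendsto_eventually) (use eventually_gt_at_top[of 0] in eventually_elim, simp add: sum_sibuya_coeff)
  from *[OF nn_integral_mainardi_le[OF assms this]]
  show "set_integrable lborel {0..} (mainardi \<alpha>)" by simp
  have "(\<lambda>m. real m powr (- \<alpha> * real 1) * (\<Sum>j\<le>m. fact (j + 1) / fact j * sibuya_coeff \<alpha> m j)) \<longlonglongrightarrow> rGamma (1 + \<alpha>)"
  proof -
    have "(\<Sum>j\<le>m. fact (j + 1) / fact j * sibuya_coeff \<alpha> m j) = neg_binomial_fps (1 + \<alpha>) $ m" for m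
      by (simp add: sum_Suc_sibuya_coeff[symmetric])
    then show ?thesis using powr_neg_binomial_fps_LIMSEQ[of "-\<alpha>"] by simp
  qed
  from *[OF nn_integral_mainardi_le[OF assms this]]
  show "set_integrable lborel {0..} (\<lambda>\<theta>. \<theta> * mainardi \<alpha> \<theta>)" by simp
qed

text \<open>The value at 0 is \<open>1 / Gamma (1 - \<alpha>) > 0\<close>, and the function is
  continuous. All lower bounds for the solution operators use only these small
  \<open>\<theta>\<close>; the cap \<open>\<delta> \<le> 1\<close> keeps the heat time
  \<open>t powr \<gamma> * \<theta>\<close> below \<open>t powr \<gamma>\<close>.\<close>

lemma mainardi_pos_near_0:
  assumes "0 < \<alpha>" "\<alpha> < 1"
  obtains \<mu> \<delta> where "0 < \<mu>" "0 < \<delta>" "\<delta> \<le> 1" "\<And>\<theta>. 0 \<le> \<theta> \<Longrightarrow> \<theta> \<le> \<delta> \<Longrightarrow> \<mu> \<le> mainardi \<alpha> \<theta>"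
proof -
  define \<mu> where "\<mu> = rGamma (1 - \<alpha>) / 2"
  have "0 < Gamma (1 - \<alpha>)" using assms by (intro Gamma_real_pos) auto
  then have mu: "0 < \<mu>" by (simp add: \<mu>_def rGamma_inverse_Gamma)
  have "(mainardi \<alpha> \<longlongrightarrow> rGamma (1 - \<alpha>)) (at 0)"
    using isCont_mainardi[OF assms, of 0] by (simp add: isCont_def mainardi_0)
  then have "\<forall>\<^sub>F \<theta> in at 0. \<mu> < mainardi \<alpha> \<theta>"
    by (rule order_tendstoD) (use mu in \<open>simp add: \<mu>_def\<close>)
  then obtain d where d: "0 < d" "\<And>\<theta>. \<theta> \<noteq> 0 \<Longrightarrow> \<bar>\<theta>\<bar> < d \<Longrightarrow> \<mu> < mainardi \<alpha> \<theta>"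
    by (auto simp: eventually_at dist_real_def)
  show ?thesis
  proof (rule that[of \<mu> "min 1 (d/2)"])
    fix \<theta> assume "0 \<le> \<theta>" "\<theta> \<le> min 1 (d/2)"
    then show "\<mu> \<le> mainardi \<alpha> \<theta>"
      using d(1) d(2)[of \<theta>] mu by (cases "\<theta> = 0") (auto simp: mainardi_0 \<mu>_def)
  qed (use d mu in auto)
qed

subsection \<open>Lower bounds for the heat semigroup\<close>

lemma nn_integral_exp_neg_square:
  assumes "0 < s"
  shows "(\<integral>\<^sup>+x. ennreal (exp (- (x\<^sup>2) / (4 * s))) \<partial>lborel) = ennreal (sqrt (4 * pi * s))"
proof -
  define \<sigma> where "\<sigma> = sqrt (2 * s)"
  have \<sigma>: "0 < \<sigma>" "\<sigma>\<^sup>2 = 2 * s" using assms by (auto simp: \<sigma>_def)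
  have "(\<integral>\<^sup>+x. ennreal (exp (- (x\<^sup>2) / (4 * s))) \<partial>lborel)
     = (\<integral>\<^sup>+x. ennreal (sqrt (4 * pi * s)) * ennreal (normal_density 0 \<sigma> x) \<partial>lborel)"
    using assms by (intro nn_integral_cong)
      (simp add: normal_density_def \<sigma>(2) ennreal_mult'[symmetric] mult_ac)
  also have "\<dots> = ennreal (sqrt (4 * pi * s)) * (\<integral>\<^sup>+x. ennreal (normal_density 0 \<sigma> x) \<partial>lborel)"
    by (rule nn_integral_cmult) measurable
  also have "(\<integral>\<^sup>+x. ennreal (normal_density 0 \<sigma> x) \<partial>lborel) = ennreal (\<integral>x. normal_density 0 \<sigma> x \<partial>lborel)"
    using \<sigma> by (intro nn_integral_eq_integral) auto
  also have "\<dots> = 1" using \<sigma> by simp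
  finally show ?thesis by simp
qed

lemma borel_measurable_heat_kernel [measurable]:
  "(\<lambda>(s, z). heat_kernel s (z :: 'a::euclidean_space)) \<in> borel_measurable (borel \<Otimes>\<^sub>M borel)"
  unfolding heat_kernel_def split_beta by measurable

lemma heat_kernel_pos: "0 < s \<Longrightarrow> 0 < heat_kernel s z"
  by (simp add: heat_kernel_def)

text \<open>After a translation and a reflection the kernel is a product of one-dimensional
  Gaussians, each of which is a multiple of the normal density with variance
  \<open>2 * s\<close>.\<close>

lemma nn_integral_heat_kernel:
  fixes x :: "'a::euclidean_space"
  assumes "0 < s"
  shows "(\<integral>\<^sup>+y. ennreal (heat_kernel s (x - y)) \<partial>lborel) = 1"
proof -
  let ?N = "DIM('a)"
  let ?c = "(4 * pi * s) powr (- real ?N / 2)"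
  have "(\<integral>\<^sup>+y. ennreal (heat_kernel s (x - y)) \<partial>lborel) = (\<integral>\<^sup>+y. ennreal (heat_kernel s (y::'a)) \<partial>lborel)"
  proof -
    have "(\<integral>\<^sup>+y. ennreal (heat_kernel s (y::'a)) \<partial>lborel)
       = (\<integral>\<^sup>+y. ennreal (heat_kernel s y) \<partial>distr lborel borel (\<lambda>y. (- x) + y))"
      by (subst lborel_distr_plus) simp
    also have "\<dots> = (\<integral>\<^sup>+y. ennreal (heat_kernel s (- x + y)) \<partial>lborel)"
      by (subst nn_integral_distr) (auto simp: heat_kernel_def)
    also have "\<dots> = (\<integral>\<^sup>+y. ennreal (heat_kernel s (x - y)) \<partial>lborel)"
      by (intro nn_integral_cong) (simp add: heat_kernel_def norm_minus_commute)
    finally show ?thesis by simp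
  qed
  also have "\<dots> = (\<integral>\<^sup>+y. ennreal ?c * (\<Prod>b\<in>Basis. ennreal (exp (- (((y::'a) \<bullet> b)\<^sup>2) / (4 * s)))) \<partial>lborel)"
  proof (intro nn_integral_cong)
    fix y :: 'a
    have "- ((norm y)\<^sup>2) / (4 * s) = (\<Sum>b\<in>Basis. - ((y \<bullet> b)\<^sup>2) / (4 * s))"
      unfolding power2_norm_eq_inner euclidean_inner[of y y]
      by (simp add: sum_divide_distrib sum_negf power2_eq_square)
    then have "exp (- ((norm y)\<^sup>2) / (4 * s)) = (\<Prod>b\<in>Basis. exp (- ((y \<bullet> b)\<^sup>2) / (4 * s)))"
      by (simp only: exp_sum[OF finite_Basis])
    then show "ennreal (heat_kernel s y) = ennreal ?c * (\<Prod>b\<in>Basis. ennreal (exp (- ((y \<bullet> b)\<^sup>2) / (4 * s))))"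
      by (simp add: heat_kernel_def ennreal_mult' prod_ennreal)
  qed
  also have "\<dots> = ennreal ?c * (\<integral>\<^sup>+y. (\<Prod>b\<in>Basis. ennreal (exp (- (((y::'a) \<bullet> b)\<^sup>2) / (4 * s)))) \<partial>lborel)"
    by (rule nn_integral_cmult) measurable
  also have "(\<integral>\<^sup>+y. (\<Prod>b\<in>Basis. ennreal (exp (- (((y::'a) \<bullet> b)\<^sup>2) / (4 * s)))) \<partial>lborel)
     = (\<Prod>b\<in>(Basis::'a set). (\<integral>\<^sup>+x. ennreal (exp (- (x\<^sup>2) / (4 * s))) \<partial>lborel))"
    by (rule nn_integral_lborel_prod) auto
  also have "\<dots> = ennreal (sqrt (4 * pi * s) ^ ?N)"
    unfolding nn_integral_exp_neg_square[OF assms] using assms by (simp add: ennreal_power)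
  also have "ennreal ?c * \<dots> = ennreal (?c * sqrt (4 * pi * s) ^ ?N)"
    by (simp add: ennreal_mult')
  also have "?c * sqrt (4 * pi * s) ^ ?N = 1"
  proof -
    have "sqrt (4 * pi * s) ^ ?N = (4 * pi * s) powr (real ?N / 2)"
      using assms by (simp add: powr_half_sqrt[symmetric] powr_realpow[symmetric] powr_powr)
    then show ?thesis using assms by (simp add: powr_add[symmetric])
  qed
  finally show ?thesis by simp
qed

lemma heat_kernel_integral:
  fixes x :: "'a::euclidean_space"
  assumes "0 < s"
  shows "integrable lborel (\<lambda>y. heat_kernel s (x - y))" "(\<integral>y. heat_kernel s (x - y) \<partial>lborel) = 1"
proof -
  have nn: "0 \<le> heat_kernel s (x - y)" for y
    using heat_kernel_pos[OF assms, of "x - y"] by simp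
  show *: "integrable lborel (\<lambda>y. heat_kernel s (x - y))"
    by (rule integrableI_nonneg) (auto simp: nn nn_integral_heat_kernel[OF assms])
  show "(\<integral>y. heat_kernel s (x - y) \<partial>lborel) = 1"
    using nn_integral_eq_integral[OF *] nn by (simp add: nn_integral_heat_kernel[OF assms])
qed

lemma heat_integrand_integrable:
  fixes w :: "'a::euclidean_space \<Rightarrow> real"
  assumes "0 < s" "w \<in> borel_measurable borel" "\<And>y. \<bar>w y\<bar> \<le> B"
  shows "integrable lborel (\<lambda>y. heat_kernel s (x - y) * w y)"
proof (rule Bochner_Integration.integrable_bound)
  show "integrable lborel (\<lambda>y. B * heat_kernel s (x - y))"
    using heat_kernel_integral(1)[OF assms(1), of x] by simp
  show "AE y in lborel. norm (heat_kernel s (x - y) * w y) \<le> norm (B * heat_kernel s (x - y))"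
  proof (rule AE_I2)
    fix y
    have "norm (heat_kernel s (x - y) * w y) = \<bar>w y\<bar> * heat_kernel s (x - y)"
      using heat_kernel_pos[OF assms(1), of "x - y"] by (simp add: abs_mult)
    also have "\<dots> \<le> \<bar>B\<bar> * heat_kernel s (x - y)"
      using heat_kernel_pos[OF assms(1), of "x - y"] assms(3)[of y] by (intro mult_right_mono) auto
    finally show "norm (heat_kernel s (x - y) * w y) \<le> norm (B * heat_kernel s (x - y))"
      using heat_kernel_pos[OF assms(1), of "x - y"] by (simp add: abs_mult)
  qed
qed (use assms in measurable)

lemma heat_sg_abs_le:
  fixes w :: "'a::euclidean_space \<Rightarrow> real"
  assumes "w \<in> borel_measurable borel" "\<And>y. \<bar>w y\<bar> \<le> B"
  shows "\<bar>heat_sg s w x\<bar> \<le> B"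
proof (cases "0 < s")
  case True
  have "\<bar>\<integral>y. heat_kernel s (x - y) * w y \<partial>lborel\<bar> \<le> (\<integral>y. \<bar>heat_kernel s (x - y) * w y\<bar> \<partial>lborel)"
    by (rule integral_abs_bound)
  also have "\<dots> \<le> (\<integral>y. B * heat_kernel s (x - y) \<partial>lborel)"
  proof (rule integral_mono)
    show "integrable lborel (\<lambda>y. \<bar>heat_kernel s (x - y) * w y\<bar>)"
      using heat_integrand_integrable[OF True assms] by (rule integrable_abs)
    show "integrable lborel (\<lambda>y. B * heat_kernel s (x - y))"
      using heat_kernel_integral(1)[OF True, of x] by simp
    fix y
    show "\<bar>heat_kernel s (x - y) * w y\<bar> \<le> B * heat_kernel s (x - y)"
      using heat_kernel_pos[OF True, of "x - y"] assms(2)[of y] by (simp add: abs_mult mult.commute mult_right_mono)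
  qed
  also have "\<dots> = B" using heat_kernel_integral[OF True, of x] by simp
  finally show ?thesis using True by (simp add: heat_sg_def)
qed (use assms in \<open>simp add: heat_sg_def\<close>)

lemma heat_sg_nonneg:
  assumes "\<And>y. 0 \<le> w y"
  shows "0 \<le> heat_sg s w x"
proof (cases "0 < s")
  case True
  then show ?thesis
    by (auto simp: heat_sg_def intro!: Bochner_Integration.integral_nonneg mult_nonneg_nonneg assms less_imp_le[OF heat_kernel_pos])
qed (simp add: heat_sg_def assms)

text \<open>Only the ball is kept in the integral; there the kernel is at least its value at
  distance \<open>d\<close>, and the last factor is the volume of the ball.\<close>

lemma heat_sg_ge_on_ball:
  fixes w :: "'a::euclidean_space \<Rightarrow> real"
  assumes s: "0 < s" and w: "w \<in> borel_measurable borel" "\<And>y. \<bar>w y\<bar> \<le> B" "\<And>y. 0 \<le> w y"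
    and m: "0 \<le> m" "\<And>y. y \<in> ball c r \<Longrightarrow> m \<le> w y"
    and d: "\<And>y. y \<in> ball c r \<Longrightarrow> norm (x - y) \<le> d" and r: "0 < r"
  shows "m * ((4 * pi * s) powr (- real DIM('a) / 2) * exp (- (d\<^sup>2) / (4 * s)) * (r ^ DIM('a) * measure lborel (ball (0::'a) 1))) \<le> heat_sg s w x"
proof -
  define K where "K = (4 * pi * s) powr (- real DIM('a) / 2) * exp (- (d\<^sup>2) / (4 * s))"
  have K: "0 \<le> K" by (simp add: K_def)
  have ball: "measure lborel (ball c r) = r ^ DIM('a) * measure lborel (ball (0::'a) 1)"
    using content_ball_conv_unit_ball[of r c] r by simp
  have "m * K * measure lborel (ball c r) = (\<integral>y. indicator (ball c r) y * (m * K) \<partial>lborel)"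
    by simp
  also have "\<dots> \<le> (\<integral>y. heat_kernel s (x - y) * w y \<partial>lborel)"
  proof (rule integral_mono)
    show "integrable lborel (\<lambda>y. indicator (ball c r) y * (m * K))"
      using emeasure_lborel_ball_finite by (intro integrable_mult_left integrable_real_indicator) auto
    show "integrable lborel (\<lambda>y. heat_kernel s (x - y) * w y)"
      by (rule heat_integrand_integrable[OF s w(1,2)])
    fix y
    have "m * K \<le> heat_kernel s (x - y) * w y" if y: "y \<in> ball c r"
    proof -
      have "(norm (x - y))\<^sup>2 \<le> d\<^sup>2" using d[OF y] by (intro power_mono) auto
      then have "K \<le> heat_kernel s (x - y)"
        unfolding K_def heat_kernel_def using s by (intro mult_left_mono) (auto simp: divide_right_mono)
      then have "m * K \<le> w y * heat_kernel s (x - y)" using m K y w by (intro mult_mono) auto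
      then show ?thesis by (simp add: mult.commute)
    qed
    moreover have "0 \<le> heat_kernel s (x - y) * w y"
      using heat_kernel_pos[OF s, of "x - y"] w(3)[of y] by simp
    ultimately show "indicator (ball c r) y * (m * K) \<le> heat_kernel s (x - y) * w y"
      by (auto simp: indicator_def)
  qed
  finally show ?thesis using s by (simp add: heat_sg_def K_def ball mult_ac)
qed

text \<open>The factor in \<open>heat_sg_ge_on_ball\<close> for a ball of radius
  \<open>sqrt s / 2\<close> and distance \<open>d = sqrt s\<close>. All powers of \<open>s\<close>
  cancel, so the constant depends on the dimension alone.\<close>

definition heat_const :: "'a::euclidean_space itself \<Rightarrow> real" where
  "heat_const _ = (4 * pi) powr (- real DIM('a) / 2) * exp (- 1 / 4) * ((1/2) ^ DIM('a) * measure lborel (ball (0::'a) 1))"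

lemma heat_const_pos: "0 < heat_const TYPE('a::euclidean_space)"
  using content_ball_pos[of 1 "0::'a"] by (simp add: heat_const_def)

text \<open>At time \<open>s\<close> the kernel acts on the scale \<open>sqrt s \<le> r\<close>.
  Even for \<open>x\<close> on the boundary, a ball of radius \<open>sqrt s / 2\<close> near
  \<open>x\<close> fits into \<open>cball 0 r\<close>, so a fixed fraction of the heat comes from
  where \<open>w \<ge> m\<close>. The minimum with 1 covers \<open>s = 0\<close>, where the
  semigroup is the identity.\<close>

lemma heat_sg_ge_const_on_cball:
  fixes w :: "'a::euclidean_space \<Rightarrow> real"
  assumes s: "0 \<le> s" "s \<le> r\<^sup>2" and r: "0 < r" and x: "norm x \<le> r"
    and w: "w \<in> borel_measurable borel" "\<And>y. \<bar>w y\<bar> \<le> B" "\<And>y. 0 \<le> w y"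
    and m: "0 \<le> m" "\<And>y. norm y \<le> r \<Longrightarrow> m \<le> w y"
  shows "min 1 (heat_const TYPE('a)) * m \<le> heat_sg s w x"
proof (cases "s = 0")
  case True
  have "min 1 (heat_const TYPE('a)) * m \<le> 1 * m" using m by (intro mult_right_mono) auto
  then show ?thesis using True m(2)[OF x] by (simp add: heat_sg_def)
next
  case False
  define \<rho> where "\<rho> = sqrt s"
  have \<rho>: "0 < \<rho>" "\<rho> \<le> r" "\<rho>\<^sup>2 = s"
    using False s r by (auto simp: \<rho>_def real_le_lsqrt)
  \<comment> \<open>The ball of radius \<open>\<rho>/2\<close> around \<open>c\<close> lies in \<open>cball 0 r\<close> and within distance \<open>\<rho>\<close> of \<open>x\<close>.\<close>
  define c where "c = (1 - \<rho> / (2 * r)) *\<^sub>R x"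
  have xc: "norm (x - c) \<le> \<rho> / 2"
  proof -
    have "x - c = (\<rho> / (2 * r)) *\<^sub>R x" by (simp add: c_def algebra_simps)
    then have "norm (x - c) = \<rho> / (2 * r) * norm x" using \<rho> r by simp
    also have "\<dots> \<le> \<rho> / (2 * r) * r" using \<rho> r x by (intro mult_left_mono) auto
    finally show ?thesis using r by simp
  qed
  have cn: "norm c \<le> r - \<rho> / 2"
  proof -
    have "0 \<le> 1 - \<rho> / (2 * r)" using \<rho> r by (simp add: field_simps)
    then have "norm c \<le> (1 - \<rho> / (2 * r)) * r" using x by (simp add: c_def mult_left_mono)
    then show ?thesis using r by (simp add: algebra_simps)
  qed
  have "m * ((4 * pi * s) powr (- real DIM('a) / 2) * exp (- (\<rho>\<^sup>2) / (4 * s)) * ((\<rho>/2) ^ DIM('a) * measure lborel (ball (0::'a) 1))) \<le> heat_sg s w x"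
  proof (rule heat_sg_ge_on_ball[of s w B m c "\<rho>/2" x \<rho>])
    fix y assume "y \<in> ball c (\<rho>/2)"
    then have y: "norm (c - y) \<le> \<rho> / 2" by (simp add: dist_norm)
    have "norm y \<le> norm c + norm (c - y)" by (metis norm_triangle_sub norm_minus_commute add.commute)
    then show "m \<le> w y" using cn y by (intro m) linarith
    have "norm (x - y) \<le> norm (x - c) + norm (c - y)" by (metis norm_triangle_ineq diff_add_cancel add_diff_eq)
    then show "norm (x - y) \<le> \<rho>" using xc y by linarith
  qed (use False s w m \<rho> in auto)
  also have "(4 * pi * s) powr (- real DIM('a) / 2) * exp (- (\<rho>\<^sup>2) / (4 * s)) * ((\<rho>/2) ^ DIM('a) * measure lborel (ball (0::'a) 1)) = heat_const TYPE('a)"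
  proof -
    have "s powr (- real DIM('a) / 2) * \<rho> ^ DIM('a) = 1"
    proof -
      have "\<rho> ^ DIM('a) = s powr (real DIM('a) / 2)"
        using \<rho> False s by (simp add: \<rho>_def powr_half_sqrt[symmetric] powr_realpow[symmetric] powr_powr)
      then show ?thesis using False s by (simp add: powr_add[symmetric])
    qed
    then show ?thesis using \<rho> False s
      by (simp add: heat_const_def powr_mult power_divide mult_ac power_one_over)
  qed
  finally have "heat_const TYPE('a) * m \<le> heat_sg s w x" by (simp add: mult.commute)
  moreover have "min 1 (heat_const TYPE('a)) * m \<le> heat_const TYPE('a) * m"
    using m by (intro mult_right_mono) auto
  ultimately show ?thesis by linarith
qed

subsection \<open>Duhamel integrals\<close>

lemma C0_bounded:
  fixes w :: "'a::euclidean_space \<Rightarrow> real"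
  assumes "w \<in> C0"
  obtains B where "\<And>x. \<bar>w x\<bar> \<le> B"
proof -
  have cont: "continuous_on UNIV w" and lim: "(w \<longlongrightarrow> 0) at_infinity"
    using assms by (auto simp: C0_def)
  from tendstoD[OF lim, of 1] obtain b where b: "\<And>x. b \<le> norm x \<Longrightarrow> \<bar>w x\<bar> < 1"
    by (auto simp: eventually_at_infinity)
  have "compact (w ` cball 0 b)"
    by (intro compact_continuous_image continuous_on_subset[OF cont]) auto
  then obtain B where B: "\<And>x. norm x \<le> b \<Longrightarrow> \<bar>w x\<bar> \<le> B"
    unfolding bounded_iff by (metis compact_imp_bounded bounded_iff imageI mem_cball_0 real_norm_def)
  show ?thesis
  proof (rule that[of "max 1 B"])
    fix x show "\<bar>w x\<bar> \<le> max 1 B"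
      using b[of x] B[of x] by (cases "norm x \<le> b") auto
  qed
qed

lemma cont_C0_path_bounded:
  fixes u :: "real \<Rightarrow> 'a::euclidean_space \<Rightarrow> real"
  assumes "cont_C0_path T u"
  obtains B where "0 \<le> B" "\<And>t x. t \<in> {0..T} \<Longrightarrow> \<bar>u t x\<bar> \<le> B"
proof -
  have C0: "\<And>t. t \<in> {0..T} \<Longrightarrow> u t \<in> C0"
    and ct: "\<And>t e. t \<in> {0..T} \<Longrightarrow> e > 0 \<Longrightarrow> \<exists>d>0. \<forall>s\<in>{0..T}. \<bar>s - t\<bar> < d \<longrightarrow> (\<forall>x. \<bar>u s x - u t x\<bar> \<le> e)"
    using assms by (auto simp: cont_C0_path_def)
  have "\<forall>t\<in>{0..T}. \<exists>d>0. \<forall>s\<in>{0..T}. \<bar>s - t\<bar> < d \<longrightarrow> (\<forall>x. \<bar>u s x - u t x\<bar> \<le> 1)"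
    using ct by (meson zero_less_one)
  then obtain d where d: "\<And>t. t \<in> {0..T} \<Longrightarrow> 0 < d t"
    "\<And>t s x. t \<in> {0..T} \<Longrightarrow> s \<in> {0..T} \<Longrightarrow> \<bar>s - t\<bar> < d t \<Longrightarrow> \<bar>u s x - u t x\<bar> \<le> 1"
    by metis
  have "\<forall>t\<in>{0..T}. \<exists>B. \<forall>x. \<bar>u t x\<bar> \<le> B" using C0_bounded[OF C0] by metis
  then obtain B where B: "\<And>t x. t \<in> {0..T} \<Longrightarrow> \<bar>u t x\<bar> \<le> B t" by metis
  have "{0..T} \<subseteq> (\<Union>t\<in>{0..T}. ball t (d t))"
    using d(1) by force
  then obtain F where F: "F \<subseteq> {0..T}" "finite F" "{0..T} \<subseteq> (\<Union>t\<in>F. ball t (d t))"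
    using compactE_image[of "{0..T}" "{0..T}" "\<lambda>t. ball t (d t)"] by (metis compact_Icc open_ball)
  show ?thesis
  proof (rule that[of "1 + (\<Sum>t\<in>F. \<bar>B t\<bar>)"])
    show "0 \<le> 1 + (\<Sum>t\<in>F. \<bar>B t\<bar>)" by (simp add: sum_nonneg add_nonneg_nonneg)
    fix s x assume s: "s \<in> {0..T}"
    then obtain t where t: "t \<in> F" "\<bar>s - t\<bar> < d t"
      using F by (auto simp: dist_real_def abs_minus_commute)
    have "\<bar>u s x - u t x\<bar> \<le> 1" by (rule d(2)) (use t s F in blast)+
    then have "\<bar>u s x\<bar> \<le> 1 + \<bar>u t x\<bar>" by linarith
    also have "\<bar>u t x\<bar> \<le> \<bar>B t\<bar>" using B[of t x] t F by fastforce
    also have "\<bar>B t\<bar> \<le> (\<Sum>t\<in>F. \<bar>B t\<bar>)" using t F by (intro member_le_sum) auto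
    finally show "\<bar>u s x\<bar> \<le> 1 + (\<Sum>t\<in>F. \<bar>B t\<bar>)" by simp
  qed
qed

lemma cont_C0_path_continuous_on:
  fixes u :: "real \<Rightarrow> 'a::euclidean_space \<Rightarrow> real"
  assumes "cont_C0_path T u"
  shows "continuous_on ({0..T} \<times> UNIV) (\<lambda>z. u (fst z) (snd z))"
proof (unfold continuous_on_iff, intro ballI allI impI)
  fix z :: "real \<times> 'a" and e :: real
  assume z: "z \<in> {0..T} \<times> UNIV" and e: "0 < e"
  obtain t x where tx: "z = (t, x)" "t \<in> {0..T}" using z by auto
  have "e / 3 > 0" using e by simp
  then obtain d1 where d1: "0 < d1" "\<And>s y. s \<in> {0..T} \<Longrightarrow> \<bar>s - t\<bar> < d1 \<Longrightarrow> \<bar>u s y - u t y\<bar> \<le> e / 3"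
    using assms tx(2) unfolding cont_C0_path_def by meson
  have "isCont (u t) x"
    using assms tx(2) by (auto simp: cont_C0_path_def C0_def continuous_on_eq_continuous_at)
  then obtain d2 where d2: "0 < d2" "\<And>y. dist y x < d2 \<Longrightarrow> \<bar>u t y - u t x\<bar> < e / 3"
    using \<open>e / 3 > 0\<close> unfolding continuous_at_eps_delta dist_real_def by meson
  show "\<exists>d>0. \<forall>z'\<in>{0..T} \<times> UNIV. dist z' z < d \<longrightarrow> dist (u (fst z') (snd z')) (u (fst z) (snd z)) < e"
  proof (intro exI[of _ "min d1 d2"] conjI ballI impI)
    fix z' :: "real \<times> 'a" assume z': "z' \<in> {0..T} \<times> UNIV" "dist z' z < min d1 d2"
    have "\<bar>fst z' - t\<bar> < d1" "dist (snd z') x < d2"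
      using dist_fst_le[of z' z] dist_snd_le[of z' z] z' tx by (auto simp: dist_real_def)
    then have "\<bar>u (fst z') (snd z') - u t (snd z')\<bar> \<le> e / 3" "\<bar>u t (snd z') - u t x\<bar> < e / 3"
      using d1(2) d2(2) z' by auto
    then have "\<bar>u (fst z') (snd z') - u t x\<bar> < e" by linarith
    then show "dist (u (fst z') (snd z')) (u (fst z) (snd z)) < e"
      by (simp add: tx(1) dist_real_def)
  qed (use d1 d2 in auto)
qed

text \<open>Extension by zero outside \<open>{0..T}\<close> turns joint continuity on a strip into
  joint measurability on the whole product, as needed for integrals in
  \<open>\<tau>\<close>.\<close>

lemma borel_measurable_cont_C0_path:
  fixes u :: "real \<Rightarrow> 'a::euclidean_space \<Rightarrow> real"
  assumes "cont_C0_path T u"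
  shows "(\<lambda>(t, x). indicator {0..T} t * u t x) \<in> borel_measurable (borel \<Otimes>\<^sub>M borel)"
proof -
  have "{0..T} \<times> (UNIV :: 'a set) \<in> sets borel" by (intro borel_closed closed_Times) auto
  from borel_measurable_continuous_on_indicator[OF this cont_C0_path_continuous_on[OF assms]]
  have "(\<lambda>z. indicator ({0..T} \<times> (UNIV :: 'a set)) z *\<^sub>R u (fst z) (snd z)) \<in> borel_measurable (borel \<Otimes>\<^sub>M borel)"
    by (simp add: borel_prod)
  also have "(\<lambda>z. indicator ({0..T} \<times> (UNIV :: 'a set)) z *\<^sub>R u (fst z) (snd z)) = (\<lambda>(t, x). indicator {0..T} t * u t x)"
    by (auto simp: indicator_def)
  finally show ?thesis .
qed

section \<open>Integrability and bounds of the subordinated operators\<close>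

lemma borel_measurable_heat_sg [measurable (raw)]:
  fixes W :: "'b \<Rightarrow> 'a::euclidean_space \<Rightarrow> real"
  assumes [measurable]: "(\<lambda>(z, y). W z y) \<in> borel_measurable (M \<Otimes>\<^sub>M borel)" "s \<in> borel_measurable M"
  shows "(\<lambda>z. heat_sg (s z) (W z) x) \<in> borel_measurable M"
  unfolding heat_sg_def by measurable

lemma set_integrable_subordination:
  fixes w :: "'a::euclidean_space \<Rightarrow> real"
  assumes "set_integrable lborel {0..} k" "w \<in> borel_measurable borel" "\<And>y. \<bar>w y\<bar> \<le> B"
  shows "set_integrable lborel {0..} (\<lambda>\<theta>. k \<theta> * heat_sg (a * \<theta>) w x)"
  unfolding set_integrable_def
proof (rule Bochner_Integration.integrable_bound)
  have k: "integrable lborel (\<lambda>\<theta>. indicator {0..} \<theta> *\<^sub>R k \<theta>)"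
    using assms(1) by (simp add: set_integrable_def)
  then show "integrable lborel (\<lambda>\<theta>. B * (indicator {0..} \<theta> *\<^sub>R k \<theta>))" by simp
  from k have [measurable]: "(\<lambda>\<theta>. indicator {0..} \<theta> *\<^sub>R k \<theta>) \<in> borel_measurable lborel" by simp
  note [measurable] = assms(2)
  have "(\<lambda>\<theta>. (indicator {0..} \<theta> *\<^sub>R k \<theta>) * heat_sg (a * \<theta>) w x) \<in> borel_measurable lborel"
    by measurable
  then show "(\<lambda>\<theta>. indicator {0..} \<theta> *\<^sub>R (k \<theta> * heat_sg (a * \<theta>) w x)) \<in> borel_measurable lborel"
    by (simp add: mult.assoc)
  show "AE \<theta> in lborel. norm (indicator {0..} \<theta> *\<^sub>R (k \<theta> * heat_sg (a * \<theta>) w x)) \<le> norm (B * (indicator {0..} \<theta> *\<^sub>R k \<theta>))"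
  proof (rule AE_I2)
    fix \<theta>
    have "\<bar>heat_sg (a * \<theta>) w x\<bar> \<le> \<bar>B\<bar>" using heat_sg_abs_le[OF assms(2,3), of "a * \<theta>" x] by linarith
    then show "norm (indicator {0..} \<theta> *\<^sub>R (k \<theta> * heat_sg (a * \<theta>) w x)) \<le> norm (B * (indicator {0..} \<theta> *\<^sub>R k \<theta>))"
      by (auto simp: indicator_def abs_mult mult.commute[of "\<bar>B\<bar>"] intro!: mult_left_mono)
  qed
qed

text \<open>Only \<open>\<theta>\<close> in \<open>{\<delta>/2..\<delta>}\<close> is kept, an
  interval of length \<open>\<delta>/2\<close>. Staying away from 0 bounds both the weight
  \<open>\<theta>\<close> in \<open>S_op\<close> and the heat time in \<open>P_op\<close> from
  below.\<close>

lemma subordination_ge: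
  fixes w :: "'a::euclidean_space \<Rightarrow> real"
  assumes k: "set_integrable lborel {0..} k" "\<And>\<theta>. 0 \<le> \<theta> \<Longrightarrow> 0 \<le> k \<theta>"
    and w: "w \<in> borel_measurable borel" "\<And>y. \<bar>w y\<bar> \<le> B" "\<And>y. 0 \<le> w y"
    and \<delta>: "0 < \<delta>" "0 \<le> \<kappa>" "\<And>\<theta>. \<theta> \<in> {\<delta>/2..\<delta>} \<Longrightarrow> \<kappa> \<le> k \<theta>"
    and \<eta>: "0 \<le> \<eta>" "\<And>\<theta>. \<theta> \<in> {\<delta>/2..\<delta>} \<Longrightarrow> \<eta> \<le> heat_sg (a * \<theta>) w x"
  shows "\<kappa> * \<eta> * (\<delta> / 2) \<le> (LINT \<theta>:{0..}|lborel. k \<theta> * heat_sg (a * \<theta>) w x)"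
proof -
  have "\<kappa> * \<eta> * (\<delta> / 2) = (\<integral>\<theta>. indicator {\<delta>/2..\<delta>} \<theta> * (\<kappa> * \<eta>) \<partial>lborel)"
    using \<delta>(1) by simp
  also have "\<dots> \<le> (LINT \<theta>:{0..}|lborel. k \<theta> * heat_sg (a * \<theta>) w x)"
    unfolding set_lebesgue_integral_def
  proof (rule integral_mono)
    show "integrable lborel (\<lambda>\<theta>. indicator {0..} \<theta> *\<^sub>R (k \<theta> * heat_sg (a * \<theta>) w x))"
      using set_integrable_subordination[OF k(1) w(1,2)] by (simp add: set_integrable_def)
    fix \<theta>
    have "0 \<le> heat_sg (a * \<theta>) w x" by (rule heat_sg_nonneg[OF w(3)])
    then show "indicator {\<delta>/2..\<delta>} \<theta> * (\<kappa> * \<eta>) \<le> indicator {0..} \<theta> *\<^sub>R (k \<theta> * heat_sg (a * \<theta>) w x)"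
      using k(2)[of \<theta>] \<delta> \<eta> by (auto simp: indicator_def intro: mult_mono)
  qed (use \<delta>(1) in \<open>auto intro!: integrable_mult_left integrable_real_indicator\<close>)
  finally show ?thesis .
qed

lemma P_op_nonneg:
  assumes "0 < \<gamma>" "\<gamma> < 1" "\<And>y. 0 \<le> w y"
  shows "0 \<le> P_op \<gamma> t w x"
  unfolding P_op_def set_lebesgue_integral_def using assms
  by (intro Bochner_Integration.integral_nonneg) (auto simp: indicator_def mainardi_nonneg heat_sg_nonneg)

lemma S_op_nonneg:
  assumes "0 < \<gamma>" "\<gamma> < 1" "\<And>y. 0 \<le> w y"
  shows "0 \<le> S_op \<gamma> t w x"
  unfolding S_op_def set_lebesgue_integral_def using assms
  by (intro mult_nonneg_nonneg Bochner_Integration.integral_nonneg) (auto simp: indicator_def mainardi_nonneg heat_sg_nonneg)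

lemma S_op_le:
  fixes w :: "'a::euclidean_space \<Rightarrow> real"
  assumes g: "0 < \<gamma>" "\<gamma> < 1" and w: "w \<in> borel_measurable borel" "\<And>y. \<bar>w y\<bar> \<le> B"
  shows "S_op \<gamma> t w x \<le> \<gamma> * (B * (LINT \<theta>:{0..}|lborel. \<theta> * mainardi \<gamma> \<theta>))"
  unfolding S_op_def
proof (intro mult_left_mono)
  let ?k = "\<lambda>\<theta>. \<theta> * mainardi \<gamma> \<theta>"
  have "(LINT \<theta>:{0..}|lborel. ?k \<theta> * heat_sg (t powr \<gamma> * \<theta>) w x) \<le> (LINT \<theta>:{0..}|lborel. B * ?k \<theta>)"
  proof (rule set_integral_mono)
    show "set_integrable lborel {0..} (\<lambda>\<theta>. ?k \<theta> * heat_sg (t powr \<gamma> * \<theta>) w x)"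
      by (rule set_integrable_subordination[OF set_integrable_mainardi(2)[OF g] w])
    show "set_integrable lborel {0..} (\<lambda>\<theta>. B * ?k \<theta>)"
      by (intro set_integrable_mult_right) (rule set_integrable_mainardi(2)[OF g])
    fix \<theta> :: real assume "\<theta> \<in> {0..}"
    then have "0 \<le> ?k \<theta>" using mainardi_nonneg[OF g] by simp
    moreover have "heat_sg (t powr \<gamma> * \<theta>) w x \<le> B" using heat_sg_abs_le[OF w, of "t powr \<gamma> * \<theta>" x] by linarith
    ultimately show "?k \<theta> * heat_sg (t powr \<gamma> * \<theta>) w x \<le> B * ?k \<theta>"
      by (metis mult.commute mult_left_mono)
  qed
  then show "(LINT \<theta>:{0..}|lborel. ?k \<theta> * heat_sg (t powr \<gamma> * \<theta>) w x) \<le> B * (LINT \<theta>:{0..}|lborel. ?k \<theta>)"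
    by simp
qed (use g in simp)

lemma S_op_ge:
  assumes g: "0 < \<gamma>" "\<gamma> < 1"
  obtains c where "0 < c"
    "\<And>(w :: 'a::euclidean_space \<Rightarrow> real) t r m B x. w \<in> borel_measurable borel \<Longrightarrow> (\<And>y. \<bar>w y\<bar> \<le> B) \<Longrightarrow>
      (\<And>y. 0 \<le> w y) \<Longrightarrow> 0 < r \<Longrightarrow> t powr \<gamma> \<le> r\<^sup>2 \<Longrightarrow> 0 \<le> m \<Longrightarrow>
      (\<And>y. norm y \<le> r \<Longrightarrow> m \<le> w y) \<Longrightarrow> norm x \<le> r \<Longrightarrow> c * m \<le> S_op \<gamma> t w x"
proof -
  obtain \<mu> \<delta> where \<mu>: "0 < \<mu>" "0 < \<delta>" "\<delta> \<le> 1" "\<And>\<theta>. 0 \<le> \<theta> \<Longrightarrow> \<theta> \<le> \<delta> \<Longrightarrow> \<mu> \<le> mainardi \<gamma> \<theta>"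
    using mainardi_pos_near_0[OF g] by blast
  define H where "H = min 1 (heat_const TYPE('a))"
  have H: "0 < H" using heat_const_pos by (simp add: H_def)
  show ?thesis
  proof (rule that[of "\<gamma> * ((\<delta>/2 * \<mu>) * H * (\<delta>/2))"])
    fix w :: "'a \<Rightarrow> real" and t r m B :: real and x :: 'a
    assume w: "w \<in> borel_measurable borel" "\<And>y. \<bar>w y\<bar> \<le> B" "\<And>y. 0 \<le> w y"
      and r: "0 < r" "t powr \<gamma> \<le> r\<^sup>2" and m: "0 \<le> m" "\<And>y. norm y \<le> r \<Longrightarrow> m \<le> w y" and x: "norm x \<le> r"
    have "(\<delta>/2 * \<mu>) * (H * m) * (\<delta>/2) \<le> (LINT \<theta>:{0..}|lborel. \<theta> * mainardi \<gamma> \<theta> * heat_sg (t powr \<gamma> * \<theta>) w x)"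
    proof (rule subordination_ge[OF set_integrable_mainardi(2)[OF g] _ w])
      fix \<theta> assume \<theta>: "\<theta> \<in> {\<delta>/2..\<delta>}"
      show "\<delta>/2 * \<mu> \<le> \<theta> * mainardi \<gamma> \<theta>" using \<theta> \<mu> by (intro mult_mono) auto
      have "t powr \<gamma> * \<theta> \<le> r\<^sup>2 * 1" using \<theta> \<mu> r by (intro mult_mono) auto
      then show "H * m \<le> heat_sg (t powr \<gamma> * \<theta>) w x"
        unfolding H_def using \<theta> \<mu> r x w m by (intro heat_sg_ge_const_on_cball[of _ r x w B m]) auto
    qed (use \<mu> H m mainardi_nonneg[OF g] in auto)
    then show "\<gamma> * ((\<delta>/2 * \<mu>) * H * (\<delta>/2)) * m \<le> S_op \<gamma> t w x"
      unfolding S_op_def using g by (simp add: mult_ac)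
  qed (use \<mu> H g in simp)
qed

text \<open>By continuity \<open>w \<ge> e\<close> on a small ball around \<open>x0\<close>. The
  heat times involved lie between fixed multiples of \<open>h\<close>, and all points of that ball
  are within \<open>sqrt h * D\<close> of \<open>x\<close>. The Gaussian factor thus has a lower
  bound independent of \<open>h\<close>, and the normalisation of the kernel contributes the decay
  \<open>h powr (-N/2)\<close>.\<close>

lemma P_op_ge:
  fixes w :: "'a::euclidean_space \<Rightarrow> real"
  assumes g: "0 < \<gamma>" "\<gamma> < 1" and w: "w \<in> C0" "\<And>x. 0 \<le> w x" "w x0 \<noteq> 0"
  obtains c where "0 < c" "\<And>h t x. 1 \<le> h \<Longrightarrow> h / 2 \<le> t powr \<gamma> \<Longrightarrow> t powr \<gamma> \<le> h \<Longrightarrow> norm x \<le> sqrt h \<Longrightarrow>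
      c * h powr (- real DIM('a) / 2) \<le> P_op \<gamma> t w x"
proof -
  obtain \<mu> \<delta> where \<mu>: "0 < \<mu>" "0 < \<delta>" "\<delta> \<le> 1" "\<And>\<theta>. 0 \<le> \<theta> \<Longrightarrow> \<theta> \<le> \<delta> \<Longrightarrow> \<mu> \<le> mainardi \<gamma> \<theta>"
    using mainardi_pos_near_0[OF g] by blast
  have cont: "continuous_on UNIV w" using w by (simp add: C0_def)
  then have meas: "w \<in> borel_measurable borel" by (rule borel_measurable_continuous_onI)
  obtain B where B: "\<And>x. \<bar>w x\<bar> \<le> B" using C0_bounded[OF w(1)] by blast
  define e where "e = w x0 / 2"
  have e: "0 < e" using w(2)[of x0] w(3) by (simp add: e_def)
  have "isCont w x0" using cont by (simp add: continuous_on_eq_continuous_at)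
  then obtain \<rho> where \<rho>: "0 < \<rho>" "\<And>y. dist y x0 < \<rho> \<Longrightarrow> \<bar>w y - w x0\<bar> < e"
    using e by (auto simp: continuous_at_eps_delta dist_real_def)
  have we: "e \<le> w y" if "y \<in> ball x0 \<rho>" for y
  proof -
    have "\<bar>w y - w x0\<bar> < e" using that by (intro \<rho>(2)) (simp add: dist_commute)
    then show ?thesis unfolding e_def by linarith
  qed
  \<comment> \<open>Since \<open>sqrt h \<ge> 1\<close>, the fixed length
    \<open>norm x0 + \<rho>\<close> is at most \<open>sqrt h\<close> times itself, so one multiple
    of \<open>sqrt h\<close> bounds all distances.\<close>
  define D where "D = 1 + norm x0 + \<rho>"
  define V where "V = \<rho> ^ DIM('a) * measure lborel (ball (0::'a) 1)"
  have V: "0 < V" using content_ball_pos[of 1 "0::'a"] \<rho> by (simp add: V_def)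
  define E where "E = e * ((4 * pi) powr (- real DIM('a) / 2) * exp (- (D\<^sup>2) / \<delta>) * V)"
  have E: "0 < E" using e V by (simp add: E_def)
  show ?thesis
  proof (rule that[of "\<mu> * E * (\<delta>/2)"])
    fix h t :: real and x :: 'a
    assume h: "1 \<le> h" "h / 2 \<le> t powr \<gamma>" "t powr \<gamma> \<le> h" "norm x \<le> sqrt h"
    have "\<mu> * (E * h powr (- real DIM('a) / 2)) * (\<delta>/2) \<le> (LINT \<theta>:{0..}|lborel. mainardi \<gamma> \<theta> * heat_sg (t powr \<gamma> * \<theta>) w x)"
    proof (rule subordination_ge[OF set_integrable_mainardi(1)[OF g] _ meas B w(2)])
      fix \<theta> assume \<theta>: "\<theta> \<in> {\<delta>/2..\<delta>}"
      show "\<mu> \<le> mainardi \<gamma> \<theta>" using \<theta> \<mu> by auto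
      define s where "s = t powr \<gamma> * \<theta>"
      have "(h / 2) * (\<delta> / 2) \<le> s" unfolding s_def using \<theta> h \<mu> by (intro mult_mono) auto
      then have s1: "h * \<delta> \<le> 4 * s" by simp
      have "s \<le> h * 1" unfolding s_def using \<theta> h \<mu> by (intro mult_mono) auto
      then have s2: "s \<le> h" by simp
      have s0: "0 < s" using s1 h \<mu> by (smt (verit) mult_pos_pos)
      have "e * ((4 * pi * s) powr (- real DIM('a) / 2) * exp (- ((sqrt h * D)\<^sup>2) / (4 * s)) * (\<rho> ^ DIM('a) * measure lborel (ball (0::'a) 1))) \<le> heat_sg s w x"
      proof (rule heat_sg_ge_on_ball[OF s0 meas B w(2)])
        fix y assume y: "y \<in> ball x0 \<rho>"
        have "norm (x - y) \<le> norm x + norm y" by (rule norm_triangle_ineq4)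
        also have "norm y \<le> norm x0 + \<rho>"
          using y norm_triangle_ineq2[of y x0] by (simp add: dist_norm norm_minus_commute)
        also have "norm x + (norm x0 + \<rho>) \<le> sqrt h * 1 + sqrt h * (norm x0 + \<rho>)"
          using h \<rho> mult_right_mono[of 1 "sqrt h" "norm x0 + \<rho>"] by (intro add_mono) auto
        also have "\<dots> = sqrt h * D" by (simp add: D_def algebra_simps)
        finally show "norm (x - y) \<le> sqrt h * D" by simp
      qed (use e we \<rho> in auto)
      moreover have "(4 * pi * h) powr (- real DIM('a) / 2) \<le> (4 * pi * s) powr (- real DIM('a) / 2)"
        using s0 s2 by (intro powr_mono2') auto
      moreover have "exp (- (D\<^sup>2) / \<delta>) \<le> exp (- ((sqrt h * D)\<^sup>2) / (4 * s))"
      proof -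
        have "(sqrt h * D)\<^sup>2 / (4 * s) \<le> (h * D\<^sup>2) / (h * \<delta>)"
          using s1 s0 h \<mu> by (intro frac_le) (auto simp: power_mult_distrib)
        also have "\<dots> = D\<^sup>2 / \<delta>" using h by simp
        finally show ?thesis by simp
      qed
      ultimately have "e * ((4 * pi * h) powr (- real DIM('a) / 2) * exp (- (D\<^sup>2) / \<delta>) * V) \<le> heat_sg s w x"
        unfolding V_def[symmetric] using e V
        by (elim order_trans[rotated], intro mult_left_mono mult_right_mono mult_mono) auto
      then show "E * h powr (- real DIM('a) / 2) \<le> heat_sg (t powr \<gamma> * \<theta>) w x"
        using h by (simp add: E_def s_def powr_mult mult_ac)
    qed (use \<mu> E mainardi_nonneg[OF g] in auto)
    then show "\<mu> * E * (\<delta>/2) * h powr (- real DIM('a) / 2) \<le> P_op \<gamma> t w x"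
      by (simp add: P_op_def mult_ac)
  qed (use \<mu> E in simp)
qed

section \<open>Integrability and lower bounds of the nonlinear terms\<close>

lemma set_integrable_powr_reflected:
  fixes t \<gamma> :: real
  assumes "0 < \<gamma>" "0 \<le> t"
  shows "set_integrable lborel {0..t} (\<lambda>\<tau>. (t - \<tau>) powr (\<gamma> - 1))"
proof -
  have "(\<lambda>x. x powr (\<gamma> - 1)) absolutely_integrable_on {0..t}"
    using has_integral_powr_from_0[of "\<gamma> - 1" t] assms
    by (intro nonnegative_absolutely_integrable_1) auto
  then have "integrable lborel (\<lambda>x. indicator {0..t} x *\<^sub>R x powr (\<gamma> - 1))"
    unfolding set_integrable_def by (subst (asm) integrable_completion) measurable
  from lborel_integrable_real_affine[OF this, of "-1" t]
  have "integrable lborel (\<lambda>x. indicator {0..t} (t - x) *\<^sub>R (t - x) powr (\<gamma> - 1))" by simp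
  moreover have "indicator {0..t} (t - x) = (indicator {0..t} x :: real)" for x
    by (auto simp: indicator_def)
  ultimately show ?thesis by (simp add: set_integrable_def)
qed

definition duhamel :: "real \<Rightarrow> real \<Rightarrow> real \<Rightarrow> (real \<Rightarrow> 'a::euclidean_space \<Rightarrow> real) \<Rightarrow> 'a \<Rightarrow> real" where
  "duhamel \<gamma> p t v x =
    (LINT \<tau>:{0..t}|lborel. (t - \<tau>) powr (\<gamma> - 1) * S_op \<gamma> (t - \<tau>) (\<lambda>y. \<bar>v \<tau> y\<bar> powr p) x)"

lemma duhamel_nonneg:
  assumes "0 < \<gamma>" "\<gamma> < 1"
  shows "0 \<le> duhamel \<gamma> p t v x"
  unfolding duhamel_def set_lebesgue_integral_def using assms
  by (intro Bochner_Integration.integral_nonneg) (auto simp: indicator_def intro!: mult_nonneg_nonneg S_op_nonneg)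

text \<open>The integrand is dominated by a constant times
  \<open>(t - \<tau>) powr (\<gamma> - 1)\<close>, as the path is bounded on \<open>{0..T}\<close>.
  Lower bounds by monotonicity need this, because the integral of a non-integrable function is 0 by
  convention.\<close>

lemma set_integrable_duhamel:
  fixes v :: "real \<Rightarrow> 'a::euclidean_space \<Rightarrow> real"
  assumes g: "0 < \<gamma>" "\<gamma> < 1" and v: "cont_C0_path T v" and t: "0 \<le> t" "t \<le> T" and p: "0 \<le> p"
  shows "set_integrable lborel {0..t} (\<lambda>\<tau>. (t - \<tau>) powr (\<gamma> - 1) * S_op \<gamma> (t - \<tau>) (\<lambda>y. \<bar>v \<tau> y\<bar> powr p) x)"
proof -
  obtain B where B: "0 \<le> B" "\<And>t x. t \<in> {0..T} \<Longrightarrow> \<bar>v t x\<bar> \<le> B"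
    using cont_C0_path_bounded[OF v] by blast
  define V where "V \<tau> y = indicator {0..T} \<tau> * v \<tau> y" for \<tau> y
  define W where "W \<tau> y = \<bar>V \<tau> y\<bar> powr p" for \<tau> y
  define C where "C = \<gamma> * (B powr p * (LINT \<theta>:{0..}|lborel. \<theta> * mainardi \<gamma> \<theta>))"
  have [measurable]: "(\<lambda>(\<tau>, y). V \<tau> y) \<in> borel_measurable (borel \<Otimes>\<^sub>M borel)"
    unfolding V_def by (rule borel_measurable_cont_C0_path[OF v])
  have W [measurable]: "(\<lambda>(\<tau>, y). W \<tau> y) \<in> borel_measurable (borel \<Otimes>\<^sub>M borel)"
    unfolding W_def by measurable
  have W1: "W \<tau> \<in> borel_measurable borel" for \<tau> by measurable
  have WB: "\<bar>W \<tau> y\<bar> \<le> B powr p" for \<tau> y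
    using B p unfolding W_def V_def by (auto simp: indicator_def intro!: powr_mono2)
  note [measurable] = borel_measurable_mainardi[OF g]
  have Sm: "(\<lambda>\<tau>. S_op \<gamma> (t - \<tau>) (W \<tau>) x) \<in> borel_measurable borel"
    unfolding S_op_def set_lebesgue_integral_def by measurable
  have S0: "0 \<le> S_op \<gamma> (t - \<tau>) (W \<tau>) x" for \<tau> by (rule S_op_nonneg[OF g]) (simp add: W_def)
  have SC: "S_op \<gamma> (t - \<tau>) (W \<tau>) x \<le> C" for \<tau>
    unfolding C_def by (rule S_op_le[OF g W1 WB])
  have "set_integrable lborel {0..t} (\<lambda>\<tau>. (t - \<tau>) powr (\<gamma> - 1) * S_op \<gamma> (t - \<tau>) (W \<tau>) x)"
    unfolding set_integrable_def
  proof (rule Bochner_Integration.integrable_bound)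
    show "integrable lborel (\<lambda>\<tau>. C * (indicator {0..t} \<tau> *\<^sub>R (t - \<tau>) powr (\<gamma> - 1)))"
      using set_integrable_powr_reflected[OF g(1) t(1)] by (simp add: set_integrable_def)
    show "AE \<tau> in lborel. norm (indicator {0..t} \<tau> *\<^sub>R ((t - \<tau>) powr (\<gamma> - 1) * S_op \<gamma> (t - \<tau>) (W \<tau>) x))
        \<le> norm (C * (indicator {0..t} \<tau> *\<^sub>R (t - \<tau>) powr (\<gamma> - 1)))"
    proof (rule AE_I2)
      fix \<tau>
      have "\<bar>S_op \<gamma> (t - \<tau>) (W \<tau>) x\<bar> \<le> \<bar>C\<bar>" using S0[of \<tau>] SC[of \<tau>] by linarith
      then show "norm (indicator {0..t} \<tau> *\<^sub>R ((t - \<tau>) powr (\<gamma> - 1) * S_op \<gamma> (t - \<tau>) (W \<tau>) x))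
        \<le> norm (C * (indicator {0..t} \<tau> *\<^sub>R (t - \<tau>) powr (\<gamma> - 1)))"
        by (auto simp: indicator_def abs_mult mult.commute[of "\<bar>C\<bar>"] intro!: mult_left_mono)
    qed
  qed (use Sm in measurable)
  moreover have "W \<tau> = (\<lambda>y. \<bar>v \<tau> y\<bar> powr p)" if "\<tau> \<in> {0..t}" for \<tau>
    using that t by (auto simp: W_def V_def)
  ultimately show ?thesis
    by (subst (asm) set_integrable_cong[OF refl]) auto
qed

text \<open>Stated as a predicate of \<open>c\<close> so that a single constant serves every path,
  exponent, radius and window length; the iteration reuses it at each step. The type argument fixes
  the space.\<close>

definition duhamel_lower_bound :: "'a::euclidean_space itself \<Rightarrow> real \<Rightarrow> real \<Rightarrow> bool" where
  "duhamel_lower_bound _ \<gamma> c \<longleftrightarrow> (\<forall>(v :: real \<Rightarrow> 'a \<Rightarrow> real) T t p \<delta> r m x.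
    cont_C0_path T v \<longrightarrow> 0 \<le> p \<longrightarrow> t \<le> T \<longrightarrow> 0 < \<delta> \<longrightarrow> \<delta> \<le> t \<longrightarrow> 0 < r \<longrightarrow> \<delta> powr \<gamma> \<le> r\<^sup>2 \<longrightarrow>
    0 \<le> m \<longrightarrow> (\<forall>\<tau>\<in>{t - \<delta>..t}. \<forall>y. norm y \<le> r \<longrightarrow> m \<le> v \<tau> y) \<longrightarrow> norm x \<le> r \<longrightarrow>
    c * m powr p * \<delta> powr \<gamma> \<le> duhamel \<gamma> p t v x)"

lemma duhamel_lower_boundD:
  fixes v :: "real \<Rightarrow> 'a::euclidean_space \<Rightarrow> real"
  assumes "duhamel_lower_bound TYPE('a) \<gamma> c" "cont_C0_path T v" "0 \<le> p" "t \<le> T" "0 < \<delta>" "\<delta> \<le> t"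
    "0 < r" "\<delta> powr \<gamma> \<le> r\<^sup>2" "0 \<le> m"
    "\<And>\<tau> y. \<tau> \<in> {t - \<delta>..t} \<Longrightarrow> norm y \<le> r \<Longrightarrow> m \<le> v \<tau> y" "norm x \<le> r"
  shows "c * m powr p * \<delta> powr \<gamma> \<le> duhamel \<gamma> p t v x"
  using assms unfolding duhamel_lower_bound_def by blast

text \<open>Only the window of length \<open>\<delta>\<close> before \<open>t\<close> is kept. There
  the singular kernel is at least \<open>\<delta> powr (\<gamma> - 1)\<close> because
  \<open>\<gamma> < 1\<close>, and \<open>S_op_ge\<close> bounds the other factor.\<close>

lemma duhamel_lower_bound_exists:
  assumes g: "0 < \<gamma>" "\<gamma> < 1"
  obtains c where "0 < c" "duhamel_lower_bound TYPE('a::euclidean_space) \<gamma> c"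
proof -
  obtain c where c: "0 < c"
    "\<And>(w :: 'a \<Rightarrow> real) t r m B x. w \<in> borel_measurable borel \<Longrightarrow> (\<And>y. \<bar>w y\<bar> \<le> B) \<Longrightarrow>
      (\<And>y. 0 \<le> w y) \<Longrightarrow> 0 < r \<Longrightarrow> t powr \<gamma> \<le> r\<^sup>2 \<Longrightarrow> 0 \<le> m \<Longrightarrow>
      (\<And>y. norm y \<le> r \<Longrightarrow> m \<le> w y) \<Longrightarrow> norm x \<le> r \<Longrightarrow> c * m \<le> S_op \<gamma> t w x"
    using S_op_ge[OF g] by blast
  show ?thesis
  proof (rule that[OF c(1)], unfold duhamel_lower_bound_def, intro allI impI)
    fix v :: "real \<Rightarrow> 'a \<Rightarrow> real" and T t p \<delta> r m :: real and x :: 'a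
    assume v: "cont_C0_path T v" and p: "0 \<le> p" and t: "t \<le> T" and \<delta>: "0 < \<delta>" "\<delta> \<le> t" "\<delta> powr \<gamma> \<le> r\<^sup>2" and r: "0 < r"
      and m: "0 \<le> m" "\<forall>\<tau>\<in>{t - \<delta>..t}. \<forall>y. norm y \<le> r \<longrightarrow> m \<le> v \<tau> y" and x: "norm x \<le> r"
    obtain B where B: "0 \<le> B" "\<And>t x. t \<in> {0..T} \<Longrightarrow> \<bar>v t x\<bar> \<le> B"
      using cont_C0_path_bounded[OF v] by blast
    let ?S = "\<lambda>\<tau>. S_op \<gamma> (t - \<tau>) (\<lambda>y. \<bar>v \<tau> y\<bar> powr p) x"
    have S: "c * m powr p \<le> ?S \<tau>" if \<tau>: "\<tau> \<in> {t - \<delta>..t}" for \<tau>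
    proof (rule c(2))
      have \<tau>': "\<tau> \<in> {0..T}" using \<tau> \<delta> t by auto
      then have "continuous_on UNIV (v \<tau>)" using v by (auto simp: cont_C0_path_def C0_def)
      then have "v \<tau> \<in> borel_measurable borel" by (rule borel_measurable_continuous_onI)
      then show "(\<lambda>y. \<bar>v \<tau> y\<bar> powr p) \<in> borel_measurable borel" by measurable
      show "\<bar>\<bar>v \<tau> y\<bar> powr p\<bar> \<le> B powr p" for y
        using B(2)[OF \<tau>'] p by (auto intro: powr_mono2)
      have "(t - \<tau>) powr \<gamma> \<le> \<delta> powr \<gamma>" using \<tau> g by (intro powr_mono2) auto
      then show "(t - \<tau>) powr \<gamma> \<le> r\<^sup>2" using \<delta> by linarith
      show "m powr p \<le> \<bar>v \<tau> y\<bar> powr p" if "norm y \<le> r" for y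
      proof (intro powr_mono2)
        show "m \<le> \<bar>v \<tau> y\<bar>" using m(2) \<tau> that by (meson abs_ge_self order_trans)
      qed (use m(1) p in auto)
    qed (use r x in auto)
    \<comment> \<open>The window is open at \<open>t\<close>: there the kernel is
      \<open>0 powr (\<gamma> - 1) = 0\<close>, and the pointwise comparison could fail.\<close>
    have "c * m powr p * \<delta> powr \<gamma> = (\<integral>\<tau>. indicator {t - \<delta>..<t} \<tau> * (\<delta> powr (\<gamma> - 1) * (c * m powr p)) \<partial>lborel)"
    proof -
      have "\<delta> powr \<gamma> = \<delta> * \<delta> powr (\<gamma> - 1)" using \<delta> powr_mult_base[of \<delta> "\<gamma> - 1"] by simp
      then show ?thesis using \<delta> by simp
    qed
    also have "\<dots> \<le> duhamel \<gamma> p t v x"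
      unfolding duhamel_def set_lebesgue_integral_def
    proof (rule integral_mono)
      show "integrable lborel (\<lambda>\<tau>. indicator {0..t} \<tau> *\<^sub>R ((t - \<tau>) powr (\<gamma> - 1) * ?S \<tau>))"
        using set_integrable_duhamel[OF g v _ t p] \<delta> by (simp add: set_integrable_def)
      fix \<tau>
      have S0: "0 \<le> ?S \<tau>" by (rule S_op_nonneg[OF g]) simp
      have "\<delta> powr (\<gamma> - 1) * (c * m powr p) \<le> (t - \<tau>) powr (\<gamma> - 1) * ?S \<tau>" if "\<tau> \<in> {t - \<delta>..<t}"
        using that g c(1) by (intro mult_mono S powr_mono2') auto
      then show "indicator {t - \<delta>..<t} \<tau> * (\<delta> powr (\<gamma> - 1) * (c * m powr p))
          \<le> indicator {0..t} \<tau> *\<^sub>R ((t - \<tau>) powr (\<gamma> - 1) * ?S \<tau>)"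
        using \<delta> S0 by (auto simp: indicator_def)
    qed (use \<delta> in \<open>auto intro!: integrable_mult_left integrable_real_indicator\<close>)
    finally show "c * m powr p * \<delta> powr \<gamma> \<le> duhamel \<gamma> p t v x" .
  qed
qed

subsection \<open>Blow-up\<close>

lemma mild_solution_swap:
  "mild_solution \<gamma>1 \<gamma>2 p q u0 v0 T u v \<Longrightarrow> mild_solution \<gamma>2 \<gamma>1 q p v0 u0 T v u"
  by (simp add: mild_solution_def)

lemma mild_solution_eqs:
  assumes "mild_solution \<gamma>1 \<gamma>2 p q u0 v0 T u v" "t \<in> {0..T}"
  shows "u t x = P_op \<gamma>1 t u0 x + duhamel \<gamma>1 p t v x" "v t x = P_op \<gamma>2 t v0 x + duhamel \<gamma>2 q t u x"
  using assms unfolding mild_solution_def duhamel_def by blast+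

lemma mild_solution_iteration_step:
  fixes u v :: "real \<Rightarrow> 'a::euclidean_space \<Rightarrow> real"
  assumes g: "0 < \<gamma>1" "\<gamma>1 < 1" "0 < \<gamma>2" "\<gamma>2 < 1" and pq: "0 \<le> p" "0 \<le> q"
    and nonneg: "\<And>x. 0 \<le> u0 x" "\<And>x. 0 \<le> v0 x"
    and sol: "mild_solution \<gamma>1 \<gamma>2 p q u0 v0 T u v"
    and c1: "0 < c1" "duhamel_lower_bound TYPE('a) \<gamma>1 c1"
    and c2: "0 < c2" "duhamel_lower_bound TYPE('a) \<gamma>2 c2"
    and r: "0 < r" and m: "0 \<le> m" and s: "0 \<le> s"
    and \<delta>: "0 < \<delta>1" "0 < \<delta>2" "\<delta>1 powr \<gamma>1 \<le> r\<^sup>2" "\<delta>2 powr \<gamma>2 \<le> r\<^sup>2"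
    and low: "\<And>t x. t \<in> {s..T'} \<Longrightarrow> norm x \<le> r \<Longrightarrow> m \<le> u t x"
    and t: "s + \<delta>1 + \<delta>2 \<le> t" "t \<le> T'" "T' \<le> T" and x: "norm x \<le> r"
  shows "c1 * (c2 * m powr q * \<delta>2 powr \<gamma>2) powr p * \<delta>1 powr \<gamma>1 \<le> u t x"
proof -
  have path: "cont_C0_path T u" "cont_C0_path T v" using sol by (auto simp: mild_solution_def)
  have v: "c2 * m powr q * \<delta>2 powr \<gamma>2 \<le> v t' y" if "t' \<in> {t - \<delta>1..t}" "norm y \<le> r" for t' y
  proof -
    have "c2 * m powr q * \<delta>2 powr \<gamma>2 \<le> duhamel \<gamma>2 q t' u y"
      using that t s \<delta> by (intro duhamel_lower_boundD[OF c2(2), where r = r and T = T] path pq r m low) auto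
    moreover have "0 \<le> P_op \<gamma>2 t' v0 y" by (rule P_op_nonneg) (use g nonneg in auto)
    moreover have "t' \<in> {0..T}" using that t s \<delta> by auto
    ultimately show ?thesis using mild_solution_eqs(2)[OF sol, of t' y] by linarith
  qed
  have "c1 * (c2 * m powr q * \<delta>2 powr \<gamma>2) powr p * \<delta>1 powr \<gamma>1 \<le> duhamel \<gamma>1 p t v x"
    using t s \<delta> c2(1) by (intro duhamel_lower_boundD[OF c1(2), where r = r and T = T] path pq r x v) auto
  moreover have "0 \<le> P_op \<gamma>1 t u0 x" by (rule P_op_nonneg) (use g nonneg in auto)
  moreover have "t \<in> {0..T}" using t s \<delta> by auto
  ultimately show ?thesis using mild_solution_eqs(1)[OF sol, of t x] by linarith
qed

text \<open>One step contributes \<open>d powr \<beta>\<close>, so halving the windows costs a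
  factor \<open>2 powr (-\<beta>)\<close> each time. \<open>A\<close> is chosen with
  \<open>A powr (p * q - 1) = 2 powr \<beta>\<close>: the superlinear gain
  \<open>M powr (p * q - 1)\<close> grows by exactly this factor per step and compensates the loss.
  The offset 3 in \<open>d\<close> accounts for \<open>2 powr (3 * \<beta>)\<close>.\<close>

lemma iteration_step_value:
  fixes p q \<gamma>1 \<gamma>2 :: real and k :: nat
  assumes pos: "0 < c1" "0 < c2" "0 < m0" "0 < \<tau>1" "0 < \<tau>2" and pq: "1 < p * q"
  defines "\<beta> \<equiv> \<gamma>1 + p * \<gamma>2"
  defines "A \<equiv> 2 powr (\<beta> / (p * q - 1))"
  assumes large: "A * 2 powr (3 * \<beta>) \<le> c1 * c2 powr p * \<tau>1 powr \<gamma>1 * \<tau>2 powr (p * \<gamma>2) * m0 powr (p * q - 1)"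
  defines "d \<equiv> 2 powr (- (real k + 3))"
  shows "m0 * A ^ Suc k \<le> c1 * (c2 * (m0 * A ^ k) powr q * (\<tau>2 * d) powr \<gamma>2) powr p * (\<tau>1 * d) powr \<gamma>1"
proof -
  define M where "M = m0 * A ^ k"
  have A: "0 < A" by (simp add: A_def)
  have M: "0 < M" using pos A by (simp add: M_def)
  have "M powr (p * q) = M * M powr (p * q - 1)"
    using M powr_mult_base[of M "p * q - 1"] by simp
  also have "M powr (p * q - 1) = m0 powr (p * q - 1) * 2 powr (\<beta> * real k)"
  proof -
    have "A ^ k = 2 powr (\<beta> / (p * q - 1) * real k)"
      unfolding A_def by (subst powr_powr[symmetric], subst powr_realpow) simp_all
    then have "(A ^ k) powr (p * q - 1) = 2 powr (\<beta> * real k)"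
      using pq by (simp add: powr_powr)
    then show ?thesis using pos A by (simp add: M_def powr_mult)
  qed
  finally have Mpq: "M powr (p * q) = M * m0 powr (p * q - 1) * 2 powr (\<beta> * real k)" by simp
  have "(c2 * M powr q * (\<tau>2 * d) powr \<gamma>2) powr p = c2 powr p * M powr (p * q) * (\<tau>2 powr (p * \<gamma>2) * d powr (p * \<gamma>2))"
    using pos M by (simp add: powr_mult powr_powr d_def mult_ac)
  then have "c1 * (c2 * M powr q * (\<tau>2 * d) powr \<gamma>2) powr p * (\<tau>1 * d) powr \<gamma>1
     = c1 * c2 powr p * \<tau>1 powr \<gamma>1 * \<tau>2 powr (p * \<gamma>2) * (M powr (p * q)) * (d powr (p * \<gamma>2) * d powr \<gamma>1)"
    using pos by (simp add: powr_mult d_def mult_ac)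
  also have "d powr (p * \<gamma>2) * d powr \<gamma>1 = 2 powr (- (3 * \<beta>)) * 2 powr (- (\<beta> * real k))"
    unfolding d_def powr_powr powr_add[symmetric] by (simp add: \<beta>_def algebra_simps)
  also have "c1 * c2 powr p * \<tau>1 powr \<gamma>1 * \<tau>2 powr (p * \<gamma>2) * (M powr (p * q)) * (2 powr (- (3 * \<beta>)) * 2 powr (- (\<beta> * real k)))
     = M * ((c1 * c2 powr p * \<tau>1 powr \<gamma>1 * \<tau>2 powr (p * \<gamma>2) * m0 powr (p * q - 1)) * 2 powr (- (3 * \<beta>)))"
    by (simp add: Mpq powr_minus field_simps)
  also have "\<dots> \<ge> M * ((A * 2 powr (3 * \<beta>)) * 2 powr (- (3 * \<beta>)))"
    using M large by (intro mult_left_mono mult_right_mono) auto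
  also have "M * ((A * 2 powr (3 * \<beta>)) * 2 powr (- (3 * \<beta>))) = M * A"
    by (simp add: powr_minus)
  finally show ?thesis by (simp add: M_def mult_ac)
qed

lemma mild_solution_time_bounded:
  fixes u0 v0 :: "'a::euclidean_space \<Rightarrow> real"
  assumes g: "0 < \<gamma>1" "\<gamma>1 < 1" "0 < \<gamma>2" "\<gamma>2 < 1"
    and u0: "u0 \<in> C0" "\<And>x. 0 \<le> u0 x" "u0 x0 \<noteq> 0" and v0: "\<And>x. 0 \<le> v0 x"
    and pq: "0 \<le> p" "0 \<le> q" "1 < p * q"
    and N: "real DIM('a) / 2 * (p * q - 1) < 1 + p * min 1 (\<gamma>2 / \<gamma>1)"
  obtains T0 where "\<And>T u v. mild_solution \<gamma>1 \<gamma>2 p q u0 v0 T u v \<Longrightarrow> T \<le> T0"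
proof -
  obtain c0 where c0: "0 < c0" "\<And>h t x. 1 \<le> h \<Longrightarrow> h / 2 \<le> t powr \<gamma>1 \<Longrightarrow> t powr \<gamma>1 \<le> h \<Longrightarrow> norm x \<le> sqrt h \<Longrightarrow>
      c0 * h powr (- real DIM('a) / 2) \<le> P_op \<gamma>1 t u0 x"
    using P_op_ge[OF g(1,2) u0] by blast
  obtain c1 where c1: "0 < c1" "duhamel_lower_bound TYPE('a) \<gamma>1 c1"
    using duhamel_lower_bound_exists[OF g(1,2), where 'a = 'a] by blast
  obtain c2 where c2: "0 < c2" "duhamel_lower_bound TYPE('a) \<gamma>2 c2"
    using duhamel_lower_bound_exists[OF g(3,4), where 'a = 'a] by blast
  define \<beta> where "\<beta> = \<gamma>1 + p * \<gamma>2"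
  define A where "A = 2 powr (\<beta> / (p * q - 1))"
  \<comment> \<open>The total exponent of \<open>h\<close> in \<open>large\<close>: 1 from
    \<open>\<tau>1 powr \<gamma>1\<close>, \<open>p * min 1 (\<gamma>2 / \<gamma>1)\<close> from
    \<open>\<tau>2\<close>, and the negative part from \<open>m0\<close>.\<close>
  define \<kappa> where "\<kappa> = 1 + p * min 1 (\<gamma>2 / \<gamma>1) - real DIM('a) / 2 * (p * q - 1)"
  have \<kappa>: "0 < \<kappa>" using N by (simp add: \<kappa>_def)
  have "0 < \<beta>" using g pq by (simp add: \<beta>_def add_pos_nonneg)
  then have A: "1 < A" using pq by (simp add: A_def)
  have "filterlim (\<lambda>h. c1 * c2 powr p * c0 powr (p * q - 1) * h powr \<kappa>) at_top at_top"
    using \<kappa> c0(1) c1(1) c2(1) by real_asymp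
  then have "\<forall>\<^sub>F h in at_top. A * 2 powr (3 * \<beta>) \<le> c1 * c2 powr p * c0 powr (p * q - 1) * h powr \<kappa>"
    by (simp add: filterlim_at_top)
  then obtain h where h: "1 \<le> h" "A * 2 powr (3 * \<beta>) \<le> c1 * c2 powr p * c0 powr (p * q - 1) * h powr \<kappa>"
    using eventually_happens'[OF _ eventually_conj[OF eventually_ge_at_top[of "1::real"]]] trivial_limit_at_top_linorder
    by blast
  define r where "r = sqrt h"
  \<comment> \<open>\<open>\<tau>1\<close> will bound the existence time. \<open>\<tau>2\<close>
    scales the windows of the second equation: it must fit into the time \<open>\<tau>1\<close> and
    also satisfy \<open>\<tau>2 powr \<gamma>2 \<le> h\<close>, the range where balls of radius
    \<open>sqrt h\<close> keep lower bounds. Hence the minimum.\<close>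
  define \<tau>1 where "\<tau>1 = h powr (1 / \<gamma>1)"
  define \<tau>2 where "\<tau>2 = h powr (min (1 / \<gamma>1) (1 / \<gamma>2))"
  define m0 where "m0 = c0 * h powr (- real DIM('a) / 2)"
  have r: "0 < r" "r\<^sup>2 = h" using h by (auto simp: r_def)
  have \<tau>: "0 < \<tau>1" "0 < \<tau>2" "\<tau>2 \<le> \<tau>1" "\<tau>1 powr \<gamma>1 = h" "\<tau>2 powr \<gamma>2 = h powr (min 1 (\<gamma>2 / \<gamma>1))"
  proof -
    have "min (1 / \<gamma>1) (1 / \<gamma>2) * \<gamma>2 = min 1 (\<gamma>2 / \<gamma>1)" using g by (auto simp: min_def field_simps)
    then show "\<tau>2 powr \<gamma>2 = h powr (min 1 (\<gamma>2 / \<gamma>1))" by (simp add: \<tau>2_def powr_powr)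
  qed (use h g in \<open>auto simp: \<tau>1_def \<tau>2_def powr_powr intro!: powr_mono\<close>)
  have \<tau>2h: "\<tau>2 powr \<gamma>2 \<le> h"
    using powr_mono[of "min 1 (\<gamma>2 / \<gamma>1)" 1 h] h \<tau>(5) by simp
  have m0: "0 < m0" using c0 h by (simp add: m0_def)
  have large: "A * 2 powr (3 * \<beta>) \<le> c1 * c2 powr p * \<tau>1 powr \<gamma>1 * \<tau>2 powr (p * \<gamma>2) * m0 powr (p * q - 1)"
  proof -
    have "\<tau>2 powr (p * \<gamma>2) = h powr (p * min 1 (\<gamma>2 / \<gamma>1))"
      using \<tau>(5) powr_powr[of \<tau>2 \<gamma>2 p] by (simp add: powr_powr mult.commute)
    moreover have "m0 powr (p * q - 1) = c0 powr (p * q - 1) * h powr (- (real DIM('a) / 2 * (p * q - 1)))"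
      using c0 h by (simp add: m0_def powr_mult powr_powr)
    moreover have "h powr \<kappa> = h * h powr (p * min 1 (\<gamma>2 / \<gamma>1)) * h powr (- (real DIM('a) / 2 * (p * q - 1)))"
    proof -
      have "h powr \<kappa> = h powr (1 + p * min 1 (\<gamma>2 / \<gamma>1) + - (real DIM('a) / 2 * (p * q - 1)))"
        by (simp add: \<kappa>_def)
      also have "\<dots> = h powr 1 * h powr (p * min 1 (\<gamma>2 / \<gamma>1)) * h powr (- (real DIM('a) / 2 * (p * q - 1)))"
        by (simp only: powr_add)
      finally show ?thesis using h by simp
    qed
    ultimately show ?thesis using h(2) \<tau>(4) by (simp add: mult_ac)
  qed
  have "T \<le> \<tau>1" if sol: "mild_solution \<gamma>1 \<gamma>2 p q u0 v0 T u v" for T u v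
  proof (rule ccontr)
    assume "\<not> T \<le> \<tau>1"
    then have T: "\<tau>1 \<le> T" by simp
    \<comment> \<open>The interval for \<open>k = 0\<close> starts at \<open>\<tau>1 / 2\<close>,
      where the linear part alone supplies \<open>m0\<close>. All the intervals contain
      \<open>\<tau>1\<close>.\<close>
    have *: "m0 * A ^ k \<le> u t x" if "t \<in> {\<tau>1 * (1 - 2 powr (- (real k + 1)))..\<tau>1}" "norm x \<le> r" for k t x
      using that
    proof (induction k arbitrary: t x)
      case 0
      then have t: "\<tau>1 / 2 \<le> t" "t \<le> \<tau>1" by (auto simp: powr_minus field_simps)
      have "h / 2 \<le> t powr \<gamma>1"
      proof -
        have "h / 2 = h * (1/2) powr 1" by simp
        also have "\<dots> \<le> h * (1/2) powr \<gamma>1" using h g by (intro mult_left_mono powr_mono') auto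
        also have "\<dots> = (\<tau>1 * (1/2)) powr \<gamma>1" by (subst powr_mult) (use \<tau> in auto)
        also have "\<dots> \<le> t powr \<gamma>1" using t g \<tau> by (intro powr_mono2) auto
        finally show ?thesis .
      qed
      moreover have "t powr \<gamma>1 \<le> h" using t g \<tau> powr_mono2[of \<gamma>1 t \<tau>1] by auto
      ultimately have "m0 \<le> P_op \<gamma>1 t u0 x"
        unfolding m0_def using h 0 by (intro c0(2)) (auto simp: r_def)
      moreover have "0 \<le> duhamel \<gamma>1 p t v x" by (rule duhamel_nonneg[OF g(1,2)])
      moreover have "t \<in> {0..T}" using t \<tau> T by auto
      ultimately show ?case using mild_solution_eqs(1)[OF sol, of t x] by simp
    next
      case (Suc k)
      define s where "s = \<tau>1 * (1 - 2 powr (- (real k + 1)))"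
      \<comment> \<open>Consecutive left endpoints differ by \<open>2 * d * \<tau>1\<close>, which
        leaves room for a window \<open>\<tau>1 * d\<close> for \<open>u\<close> and one of length
        \<open>\<tau>2 * d \<le> \<tau>1 * d\<close> for \<open>v\<close>.\<close>
      define d :: real where "d = 2 powr (- (real k + 3))"
      have d: "0 < d" "d \<le> 1"
        using powr_mono[of "- (real k + 3)" 0 2] by (simp_all add: d_def)
      have "2 powr (- (real k + 1)) = 4 * d" "2 powr (- (real (Suc k) + 1)) = 2 * d"
      proof -
        have "- (real k + 1) = 2 + - (real k + 3)" "- (real (Suc k) + 1) = 1 + - (real k + 3)" by auto
        then show "2 powr (- (real k + 1)) = 4 * d" "2 powr (- (real (Suc k) + 1)) = 2 * d"
          unfolding d_def by (simp_all only: powr_add) simp_all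
      qed
      then have s: "s = \<tau>1 * (1 - 4 * d)" "\<tau>1 * (1 - 2 powr (- (real (Suc k) + 1))) = \<tau>1 * (1 - 2 * d)"
        by (simp_all add: s_def)
      have "2 powr (- (real k + 1)) \<le> (1::real)" using powr_mono[of "- (real k + 1)" 0 2] by simp
      then have s0: "0 \<le> s" using \<tau> by (simp add: s_def)
      have "c1 * (c2 * (m0 * A ^ k) powr q * (\<tau>2 * d) powr \<gamma>2) powr p * (\<tau>1 * d) powr \<gamma>1 \<le> u t x"
      proof (rule mild_solution_iteration_step[OF g pq(1,2) u0(2) v0 sol c1 c2 r(1) _ s0])
        show "(\<tau>1 * d) powr \<gamma>1 \<le> r\<^sup>2"
          using powr_mono2[of \<gamma>1 "\<tau>1 * d" "\<tau>1 * 1"] \<tau> g d r by (simp add: mult_left_le)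
        show "(\<tau>2 * d) powr \<gamma>2 \<le> r\<^sup>2"
          using powr_mono2[of \<gamma>2 "\<tau>2 * d" "\<tau>2 * 1"] \<tau> \<tau>2h g d r by (simp add: mult_left_le)
        show "m0 * A ^ k \<le> u t x" if "t \<in> {s..\<tau>1}" "norm x \<le> r" for t x
          using Suc.IH that by (simp add: s_def)
        have "s + \<tau>1 * d + \<tau>2 * d \<le> s + \<tau>1 * d + \<tau>1 * d" using \<tau> d by simp
        also have "\<dots> = \<tau>1 * (1 - 2 * d)" by (simp add: s algebra_simps)
        also have "\<dots> \<le> t" using Suc.prems(1) unfolding s(2) atLeastAtMost_iff by blast
        finally show "s + \<tau>1 * d + \<tau>2 * d \<le> t" .
      qed (use \<tau> d m0 A T Suc.prems in auto)
      then show ?case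
        using iteration_step_value[OF c1(1) c2(1) m0 \<tau>(1,2) pq(3), of \<gamma>1 \<gamma>2 k] large
        unfolding \<beta>_def A_def d_def by linarith
    qed
    \<comment> \<open>At time \<open>\<tau>1\<close> all the lower bounds hold at once, which
      contradicts the finiteness of \<open>u \<tau>1 0\<close>.\<close>
    obtain k where "u \<tau>1 0 / m0 < A ^ k" using real_arch_pow[OF A] by blast
    then have "u \<tau>1 0 < m0 * A ^ k" using m0 by (simp add: field_simps)
    moreover have "m0 * A ^ k \<le> u \<tau>1 0" using \<tau> r by (intro *) auto
    ultimately show False by simp
  qed
  then show ?thesis by (rule that)
qed

section \<open>From bounded existence times to the stated conditions\<close>

lemma Tmax_finite:
  assumes "\<And>T u v. mild_solution \<gamma>1 \<gamma>2 p q u0 v0 T u v \<Longrightarrow> T \<le> T0"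
  shows "Tmax \<gamma>1 \<gamma>2 p q u0 v0 < \<infinity>"
proof -
  have "Tmax \<gamma>1 \<gamma>2 p q u0 v0 \<le> ereal T0"
    unfolding Tmax_def using assms by (intro SUP_least) auto
  then show ?thesis by (rule order_le_less_trans) simp
qed

lemma Tmax_swap: "Tmax \<gamma>1 \<gamma>2 p q u0 v0 = Tmax \<gamma>2 \<gamma>1 q p v0 u0"
proof -
  have "mild_solution \<gamma>1 \<gamma>2 p q u0 v0 T u v \<longleftrightarrow> mild_solution \<gamma>2 \<gamma>1 q p v0 u0 T v u" for T u v
    using mild_solution_swap by blast
  then have "(\<exists>u v. mild_solution \<gamma>1 \<gamma>2 p q u0 v0 T u v) \<longleftrightarrow> (\<exists>v u. mild_solution \<gamma>2 \<gamma>1 q p v0 u0 T v u)" for T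
    by blast
  then show ?thesis by (simp only: Tmax_def)
qed

lemma Tmax_finite_subcritical:
  fixes u0 v0 :: "'a::euclidean_space \<Rightarrow> real"
  assumes "0 < \<gamma>1" "\<gamma>1 < 1" "0 < \<gamma>2" "\<gamma>2 < 1"
    and "u0 \<in> C0" "\<forall>x. 0 \<le> u0 x" "\<exists>x. u0 x \<noteq> 0" "\<forall>x. 0 \<le> v0 x"
    and "0 \<le> p" "0 \<le> q" "1 < p * q"
    and "real DIM('a) / 2 * (p * q - 1) < 1 + p * min 1 (\<gamma>2 / \<gamma>1)"
  shows "Tmax \<gamma>1 \<gamma>2 p q u0 v0 < \<infinity>"
  using mild_solution_time_bounded[of \<gamma>1 \<gamma>2 u0 _ v0 p q] assms Tmax_finite by metis

text \<open>The two quotients match the two values of the minimum: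
  \<open>(p + 1) / (p * q - 1)\<close> belongs to 1, the other one to
  \<open>\<gamma>2 / \<gamma>1\<close> after division by \<open>\<gamma>1\<close>.\<close>

lemma subcritical_if_less_quotients:
  fixes n p q \<gamma>1 \<gamma>2 :: real
  assumes "0 < \<gamma>1" "0 \<le> p" "1 < p * q"
    and "n < (p * \<gamma>2 + \<gamma>1) / (\<gamma>1 * (p * q - 1))" "n < (p + 1) / (p * q - 1)"
  shows "n * (p * q - 1) < 1 + p * min 1 (\<gamma>2 / \<gamma>1)"
proof -
  have "n * (p * q - 1) < p + 1"
    using assms(3,5) pos_less_divide_eq[of "p * q - 1" n "p + 1"] by auto
  moreover have "n * (p * q - 1) < 1 + p * (\<gamma>2 / \<gamma>1)"
  proof -
    have "0 < \<gamma>1 * (p * q - 1)" using assms by simp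
    then have "\<gamma>1 * (n * (p * q - 1)) < \<gamma>1 * (1 + p * (\<gamma>2 / \<gamma>1))"
      using assms(1,4) by (simp only: pos_less_divide_eq) (simp add: algebra_simps)
    then show ?thesis using assms(1) by simp
  qed
  ultimately show ?thesis by (simp add: min_def)
qed

theorem theorem3p6:
  fixes u0 v0 :: "'a::euclidean_space \<Rightarrow> real"
    and \<gamma>1 \<gamma>2 p q :: real
  defines "N \<equiv> real DIM('a)"
  assumes "0 < \<gamma>1" "\<gamma>1 < 1" "0 < \<gamma>2" "\<gamma>2 < 1"
    and "u0 \<in> C0" "v0 \<in> C0"
    and "\<forall>x. u0 x \<ge> 0" "\<forall>x. v0 x \<ge> 0"
    and "\<exists>x. u0 x \<noteq> 0" "\<exists>x. v0 x \<noteq> 0"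
  shows "(p > 1 \<and> q > 1 \<and>
           ((N / 2 < Min {(p * \<gamma>2 + \<gamma>1) / (\<gamma>1 * (p * q - 1)),
                          (q * \<gamma>1 + \<gamma>2) / (\<gamma>1 * (p * q - 1)),
                          (p * q * (\<gamma>1 - \<gamma>2) + q * \<gamma>1 + \<gamma>2) / (\<gamma>1 * (p * q - 1)),
                          (p + 1) / (p * q - 1)}) \<or>
            (N / 2 < Min {(q * \<gamma>1 + \<gamma>2) / (\<gamma>2 * (p * q - 1)),
                          (p * \<gamma>2 + \<gamma>1) / (\<gamma>2 * (p * q - 1)),
                          (p * q * (\<gamma>2 - \<gamma>1) + p * \<gamma>2 + \<gamma>1) / (\<gamma>2 * (p * q - 1)),
                          (q + 1) / (p * q - 1)}))
          \<longrightarrow> Tmax \<gamma>1 \<gamma>2 p q u0 v0 < \<infinity>)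
       \<and> (((p = 1 \<and> 1 < q \<and> q < 1 + 2 / N) \<or> (1 < p \<and> p < 1 + 2 / N \<and> q = 1))
          \<longrightarrow> Tmax \<gamma>1 \<gamma>2 p q u0 v0 < \<infinity>)"
proof -
  have N: "0 < N" by (simp add: N_def)
  have uv: "Tmax \<gamma>1 \<gamma>2 p q u0 v0 < \<infinity>"
    if "0 \<le> p" "0 \<le> q" "1 < p * q" "N / 2 * (p * q - 1) < 1 + p * min 1 (\<gamma>2 / \<gamma>1)"
    using that assms by (intro Tmax_finite_subcritical) auto
  \<comment> \<open>Exchanging the equations turns the linear part of \<open>v\<close> into the
    starting bound, with \<open>p\<close>, \<open>q\<close> and the orders interchanged.\<close>
  have vu: "Tmax \<gamma>1 \<gamma>2 p q u0 v0 < \<infinity>"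
    if "0 \<le> p" "0 \<le> q" "1 < p * q" "N / 2 * (p * q - 1) < 1 + q * min 1 (\<gamma>1 / \<gamma>2)"
    using that assms unfolding Tmax_swap[of \<gamma>1]
    by (intro Tmax_finite_subcritical) (auto simp: mult.commute)
  \<comment> \<open>For part (b): when one exponent is 1, the condition \<open>s < 1 + 2 / N\<close>
    on the other already makes the left side less than 1, and the minimum is positive.\<close>
  have one: "N / 2 * (s - 1) < 1 + min 1 (g / g')" if "1 < s" "s < 1 + 2 / N" "0 < g" "0 < g'" for s g g'
  proof -
    have "N / 2 * (s - 1) < 1" using that N by (simp add: field_simps)
    moreover have "0 < min 1 (g / g')" using that by simp
    ultimately show ?thesis by linarith
  qed
  show ?thesis
  proof (intro conjI impI; elim conjE disjE)
    assume pq: "1 < p" "1 < q"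
    then have pq': "1 < p * q" using less_1_mult by blast
    {
      assume "N / 2 < Min {(p * \<gamma>2 + \<gamma>1) / (\<gamma>1 * (p * q - 1)),
                          (q * \<gamma>1 + \<gamma>2) / (\<gamma>1 * (p * q - 1)),
                          (p * q * (\<gamma>1 - \<gamma>2) + q * \<gamma>1 + \<gamma>2) / (\<gamma>1 * (p * q - 1)),
                          (p + 1) / (p * q - 1)}"
      then show "Tmax \<gamma>1 \<gamma>2 p q u0 v0 < \<infinity>"
        using pq pq' assms by (intro uv subcritical_if_less_quotients) auto
    next
      assume "N / 2 < Min {(q * \<gamma>1 + \<gamma>2) / (\<gamma>2 * (p * q - 1)),
                          (p * \<gamma>2 + \<gamma>1) / (\<gamma>2 * (p * q - 1)),
                          (p * q * (\<gamma>2 - \<gamma>1) + p * \<gamma>2 + \<gamma>1) / (\<gamma>2 * (p * q - 1)),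
                          (q + 1) / (p * q - 1)}"
      then show "Tmax \<gamma>1 \<gamma>2 p q u0 v0 < \<infinity>"
        using pq pq' assms subcritical_if_less_quotients[of \<gamma>2 q p "N / 2" \<gamma>1] by (intro vu) (auto simp: mult.commute)
    }
  next
    assume "p = 1" "1 < q" "q < 1 + 2 / N"
    then show "Tmax \<gamma>1 \<gamma>2 p q u0 v0 < \<infinity>"
      using one[of q \<gamma>2 \<gamma>1] assms by (intro uv) auto
  next
    assume "1 < p" "p < 1 + 2 / N" "q = 1"
    then show "Tmax \<gamma>1 \<gamma>2 p q u0 v0 < \<infinity>"
      using one[of p \<gamma>1 \<gamma>2] assms by (intro vu) auto
  qed
qed

end
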